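(* (Equilibrium equations, static case.) Let $y=y(\xi)$ be a smooth embedding of a $d$-dimensional body $\mathcal{B}$ (coordinates $\xi^\alpha$) into an $n$-dimensional manifold $\mathcal{M}$ (coordinates $x^A$), let $\Theta^0_{\mathcal{B}}$ be the fixed background metric induced by a fixed initial embedding, and let $$\mathfrak{F}[y]=\int_{\mathcal{B}}\big(\mathcal{F}_0(\Delta)+\mathcal{U}(y(\xi))\big)\,\varpi\,d\xi^1\wedge\dots\wedge d\xi^d .$$ If the first variation $\delta\mathfrak{F}$ at $y$ vanishes for all smooth variations $\delta y$ that vanish on $\partial\mathcal{B}$, then for every $A=1,\dots,n$ $$\frac{1}{\varpi}\,\partial_\alpha\big(\varpi\,\widetilde\Sigma^\alpha_A\big)-\Sigma^{\alpha_1\dots\alpha_p}\,\big(\partial_A\Theta_{B_1\dots B_p}\big)\,\partial_{\alpha_1}y^{B_1}\cdots\partial_{\alpha_p}y^{B_p}-\partial_A\mathcal{U}=0$$ on $\mathcal{B}$ (all terms evaluated along $y(\xi)$), where $\Sigma=\sigma+(\mathcal{F}_0+\mathcal{U})\,(\ln\varpi)_{|\Delta}$.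
   Context: All data are smooth. $\Theta=(\Theta_{B_1\dots B_p})$ is a covariant tensor field of degree $p$ on $\mathcal{M}$; $y^*\Theta$ has components $\Theta_{B_1\dots B_p}(y)\,\partial_{\alpha_1}y^{B_1}\cdots\partial_{\alpha_p}y^{B_p}$. With $x_0:\mathcal{B}\to\mathcal{M}$ the fixed initial embedding and $\Theta^0_{\mathcal{B}}=x_0^*\Theta$, the deformation measure is $\Delta=y^*\Theta-\Theta^0_{\mathcal{B}}$. $\mathcal{F}_0$ (elastic energy density) is a real function of the components of $\Delta$ (possibly also depending explicitly on $\xi$); $\mathcal{U}$ (external potential) is a real function on $\mathcal{M}$; $\varpi>0$ is a function of the components of $y^*\Theta$ giving the volume density on $\mathcal{B}$. The subscript $|\Delta$ denotes the derivative with respect to the components of $\Delta$ (equivalently of $y^*\Theta$, with $\Theta^0_{\mathcal{B}}$ fixed); $\sigma=(\mathcal{F}_0)_{|\Delta}$ is the stress tensor; summation over repeated indices is understood, and $$\widetilde\Sigma^{\alpha}_A=\sum_{s=1}^p\Sigma^{\alpha_1\dots\alpha_{s-1}\,\alpha\,\alpha_{s+1}\dots\alpha_p}\,\Theta_{B_1\dots B_{s-1}\,A\,B_{s+1}\dots B_p}\prod_{r\neq s}\partial_{\alpha_r}y^{B_r}.$$ *)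

theory Defs
  imports "HOL-Analysis.Analysis"
begin

subsection \<open>Smooth functions between normed spaces\<close>

definition pd :: "'k::finite \<Rightarrow> (real^'k \<Rightarrow> 'b::real_normed_vector) \<Rightarrow> real^'k \<Rightarrow> 'b" where
  "pd i f x = frechet_derivative f (at x) (axis i 1)"

text \<open>Intended for open \<open>S\<close> and finite-dimensional domain, where continuity of all iterated
  directional derivatives is the usual notion of class \<open>C\<^sup>k\<close>.\<close>

primrec Ck_on :: "nat \<Rightarrow> 'a::real_normed_vector set \<Rightarrow> ('a \<Rightarrow> 'b::real_normed_vector) \<Rightarrow> bool" where
  "Ck_on 0 S f \<longleftrightarrow> continuous_on S f"
| "Ck_on (Suc k) S f \<longleftrightarrow>
     (\<forall>x\<in>S. f differentiable (at x)) \<and> (\<forall>v. Ck_on k S (\<lambda>x. frechet_derivative f (at x) v))"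

text \<open>On a set that need not be open, smoothness means smoothness on some open neighbourhood.
  As functions are total, \<open>f\<close> is its own smooth extension, and \<open>at x\<close> derivatives make sense at
  boundary points too.\<close>

definition smooth_on :: "'a::real_normed_vector set \<Rightarrow> ('a \<Rightarrow> 'b::real_normed_vector) \<Rightarrow> bool" where
  "smooth_on S f \<longleftrightarrow> (\<exists>T. open T \<and> S \<subseteq> T \<and> (\<forall>k. Ck_on k T f))"

subsection \<open>Smooth manifolds\<close>

text \<open>The manifold is the whole type \<open>'m\<close>, of dimension \<open>CARD('n)\<close>; a chart is a pair of a coordinate
  domain \<open>U\<close> and a coordinate map \<open>\<phi>\<close>, of which only the values on \<open>U\<close> matter.\<close>

type_synonym ('m, 'n) chart = "'m set \<times> ('m \<Rightarrow> real^'n)"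

definition smooth_atlas ::
  "('m::{t2_space,second_countable_topology}, 'n::finite) chart set \<Rightarrow> bool" where
  "smooth_atlas \<A> \<longleftrightarrow>
     (\<Union>(U, \<phi>)\<in>\<A>. U) = UNIV \<and>
     (\<forall>(U, \<phi>)\<in>\<A>. open U \<and> open (\<phi> ` U) \<and> homeomorphism U (\<phi> ` U) \<phi> (inv_into U \<phi>)) \<and>
     (\<forall>(U, \<phi>)\<in>\<A>. \<forall>(V, \<psi>)\<in>\<A>. smooth_on (\<phi> ` (U \<inter> V)) (\<psi> \<circ> inv_into U \<phi>))"

definition smooth_function ::
  "('m::topological_space, 'n::finite) chart set \<Rightarrow> ('m \<Rightarrow> real) \<Rightarrow> bool" where
  "smooth_function \<A> f \<longleftrightarrow> (\<forall>(U, \<phi>)\<in>\<A>. smooth_on (\<phi> ` U) (f \<circ> inv_into U \<phi>))"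

definition smooth_into ::
  "('m::topological_space, 'n::finite) chart set \<Rightarrow> 'a::real_normed_vector set \<Rightarrow> ('a \<Rightarrow> 'm) \<Rightarrow> bool" where
  "smooth_into \<A> S y \<longleftrightarrow>
     (\<exists>T. open T \<and> S \<subseteq> T \<and> continuous_on T y \<and>
          (\<forall>(U, \<phi>)\<in>\<A>. smooth_on (T \<inter> y -` U) (\<phi> \<circ> y)))"

definition smooth_embedding ::
  "('m::topological_space, 'n::finite) chart set \<Rightarrow> 'a::real_normed_vector set \<Rightarrow> ('a \<Rightarrow> 'm) \<Rightarrow> bool" where
  "smooth_embedding \<A> S y \<longleftrightarrow>
     smooth_into \<A> S y \<and>
     (\<forall>(U, \<phi>)\<in>\<A>. \<forall>\<xi>\<in>S. y \<xi> \<in> U \<longrightarrow> inj (frechet_derivative (\<phi> \<circ> y) (at \<xi>))) \<and>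
     homeomorphism S (y ` S) y (inv_into S y)"

subsection \<open>Covariant tensor fields and pull-back\<close>

text \<open>The slots \<open>1, \<dots>, p\<close> are the elements of the finite type \<open>'p\<close>, so a multi-index \<open>B\<^sub>1 \<dots> B\<^sub>p\<close> is a
  function \<open>B :: 'p \<Rightarrow> 'n\<close> and the array of components is a vector indexed by multi-indices.
  A tensor field is given by its components \<open>\<Theta> c x\<close> in each chart \<open>c\<close>, as functions of the
  coordinates \<open>x\<close>, subject to the covariant transformation law.\<close>

type_synonym ('m, 'n, 'p) tensor = "('m, 'n) chart \<Rightarrow> real^'n \<Rightarrow> real^('p \<Rightarrow> 'n)"

definition covariant_tensor_field ::
  "('m::topological_space, 'n::finite) chart set \<Rightarrow> ('m, 'n, 'p::finite) tensor \<Rightarrow> bool" where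
  "covariant_tensor_field \<A> \<Theta> \<longleftrightarrow>
     (\<forall>(U, \<phi>)\<in>\<A>. smooth_on (\<phi> ` U) (\<Theta> (U, \<phi>))) \<and>
     (\<forall>(U, \<phi>)\<in>\<A>. \<forall>(V, \<psi>)\<in>\<A>. \<forall>m\<in>U \<inter> V. \<forall>B.
        \<Theta> (U, \<phi>) (\<phi> m) $ B =
          (\<Sum>C\<in>UNIV. \<Theta> (V, \<psi>) (\<psi> m) $ C *
             (\<Prod>r\<in>UNIV. pd (B r) (\<psi> \<circ> inv_into U \<phi>) (\<phi> m) $ C r)))"

text \<open>\<open>dcoord c y \<alpha> A \<xi>\<close> is \<open>\<partial>\<^sub>\<alpha> y\<^sup>A\<close>, where \<open>y\<^sup>A\<close> are the coordinates of \<open>y\<close> in the chart \<open>c\<close>.\<close>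

definition dcoord ::
  "('m, 'n::finite) chart \<Rightarrow> (real^'d::finite \<Rightarrow> 'm) \<Rightarrow> 'd \<Rightarrow> 'n \<Rightarrow> real^'d \<Rightarrow> real" where
  "dcoord c y \<alpha> A \<xi> = pd \<alpha> (snd c \<circ> y) \<xi> $ A"

definition chart_at :: "('m, 'n::finite) chart set \<Rightarrow> 'm \<Rightarrow> ('m, 'n) chart" where
  "chart_at \<A> m = (SOME c. c \<in> \<A> \<and> m \<in> fst c)"

text \<open>By the transformation law the value does not depend on the chart chosen around \<open>y \<xi>\<close>.\<close>

definition pullback ::
  "('m, 'n::finite) chart set \<Rightarrow> ('m, 'n, 'p::finite) tensor \<Rightarrow> (real^'d::finite \<Rightarrow> 'm)
     \<Rightarrow> real^'d \<Rightarrow> real^('p \<Rightarrow> 'd)" where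
  "pullback \<A> \<Theta> y \<xi> =
     (let c = chart_at \<A> (y \<xi>) in
      (\<chi> a. \<Sum>B\<in>UNIV. \<Theta> c (snd c (y \<xi>)) $ B * (\<Prod>r\<in>UNIV. dcoord c y (a r) (B r) \<xi>)))"

definition deformation ::
  "('m, 'n::finite) chart set \<Rightarrow> ('m, 'n, 'p::finite) tensor \<Rightarrow> (real^'d::finite \<Rightarrow> 'm)
     \<Rightarrow> (real^'d \<Rightarrow> 'm) \<Rightarrow> real^'d \<Rightarrow> real^('p \<Rightarrow> 'd)" where
  "deformation \<A> \<Theta> x0 y \<xi> = pullback \<A> \<Theta> y \<xi> - pullback \<A> \<Theta> x0 \<xi>"

subsection \<open>Energy functional and variations\<close>

definition energy ::
  "('m, 'n::finite) chart set \<Rightarrow> ('m, 'n, 'p::finite) tensor \<Rightarrow> (real^'d::finite) set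
     \<Rightarrow> (real^'d \<Rightarrow> 'm) \<Rightarrow> (real^'d \<Rightarrow> real^('p \<Rightarrow> 'd) \<Rightarrow> real) \<Rightarrow> ('m \<Rightarrow> real)
     \<Rightarrow> (real^('p \<Rightarrow> 'd) \<Rightarrow> real) \<Rightarrow> (real^'d \<Rightarrow> 'm) \<Rightarrow> real" where
  "energy \<A> \<Theta> \<B> x0 F0 \<U> vol y =
     integral \<B> (\<lambda>\<xi>. (F0 \<xi> (deformation \<A> \<Theta> x0 y \<xi>) + \<U> (y \<xi>)) * vol (pullback \<A> \<Theta> y \<xi>))"

definition smooth_variation ::
  "('m::topological_space, 'n::finite) chart set \<Rightarrow> (real^'d::finite) set \<Rightarrow> (real^'d \<Rightarrow> 'm)
     \<Rightarrow> (real \<Rightarrow> real^'d \<Rightarrow> 'm) \<Rightarrow> bool" where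
  "smooth_variation \<A> \<B> y Y \<longleftrightarrow>
     (\<forall>\<xi>\<in>\<B>. Y 0 \<xi> = y \<xi>) \<and>
     (\<exists>e>0. smooth_into \<A> ({-e<..<e} \<times> \<B>) (\<lambda>(\<epsilon>, \<xi>). Y \<epsilon> \<xi>))"

text \<open>The variation \<open>\<delta>y\<close> is the tangent vector of \<open>\<epsilon> \<mapsto> Y \<epsilon> \<xi>\<close> at \<open>\<epsilon> = 0\<close>; it vanishes iff its components
  vanish in the charts around \<open>Y 0 \<xi>\<close>.\<close>

definition variation_field_zero_on ::
  "('m, 'n::finite) chart set \<Rightarrow> (real^'d::finite) set \<Rightarrow> (real \<Rightarrow> real^'d \<Rightarrow> 'm) \<Rightarrow> bool" where
  "variation_field_zero_on \<A> S Y \<longleftrightarrow>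
     (\<forall>\<xi>\<in>S. \<forall>(U, \<phi>)\<in>\<A>. Y 0 \<xi> \<in> U \<longrightarrow> ((\<lambda>\<epsilon>. \<phi> (Y \<epsilon> \<xi>)) has_vector_derivative 0) (at 0))"

subsection \<open>Generalised stress\<close>

text \<open>\<open>\<Sigma> = \<sigma> + (F0 + \<U>) (ln vol)\<^bsub>|\<Delta>\<^esub>\<close> with \<open>\<sigma> = (F0)\<^bsub>|\<Delta>\<^esub>\<close>; all components of \<open>\<Delta>\<close>
  are treated as independent variables.\<close>

definition Stress ::
  "('m, 'n::finite) chart set \<Rightarrow> ('m, 'n, 'p::finite) tensor \<Rightarrow> (real^'d::finite \<Rightarrow> 'm)
     \<Rightarrow> (real^'d \<Rightarrow> real^('p \<Rightarrow> 'd) \<Rightarrow> real) \<Rightarrow> ('m \<Rightarrow> real) \<Rightarrow> (real^('p \<Rightarrow> 'd) \<Rightarrow> real)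
     \<Rightarrow> (real^'d \<Rightarrow> 'm) \<Rightarrow> real^'d \<Rightarrow> real^('p \<Rightarrow> 'd)" where
  "Stress \<A> \<Theta> x0 F0 \<U> vol y \<xi> =
     (\<chi> a. pd a (F0 \<xi>) (deformation \<A> \<Theta> x0 y \<xi>)
         + (F0 \<xi> (deformation \<A> \<Theta> x0 y \<xi>) + \<U> (y \<xi>)) *
           pd a (\<lambda>t. ln (vol t)) (pullback \<A> \<Theta> y \<xi>))"

text \<open>\<open>\<Sigma>\<close> contracted with \<open>\<Theta>\<close> in all slots but one; the free slot \<open>s\<close> carries \<open>\<alpha>\<close> in \<open>\<Sigma>\<close> and
  \<open>A\<close> in \<open>\<Theta>\<close>.\<close>

definition Stress_tilde ::
  "('m, 'n::finite) chart \<Rightarrow> ('m, 'n, 'p::finite) tensor \<Rightarrow> (real^'d::finite \<Rightarrow> 'm)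
     \<Rightarrow> (real^'d \<Rightarrow> real^('p \<Rightarrow> 'd)) \<Rightarrow> 'd \<Rightarrow> 'n \<Rightarrow> real^'d \<Rightarrow> real" where
  "Stress_tilde c \<Theta> y \<Sigma> \<alpha> A \<xi> =
     (\<Sum>s\<in>UNIV. \<Sum>a | a s = \<alpha>. \<Sum>B | B s = A.
        \<Sigma> \<xi> $ a * \<Theta> c (snd c (y \<xi>)) $ B * (\<Prod>r\<in>UNIV - {s}. dcoord c y (a r) (B r) \<xi>))"

end

(*
  The equilibrium equations are the Euler-Lagrange equations of the energy. Around an interior point
  of the body whose image lies in a chart (U, phi), move y by eps * eta in the coordinate direction A,
  where eta is a bump function of small support. The energy then changes only on the support of eta,
  and differentiating under the integral gives the integral of the sum over alpha of
  (d_alpha eta) * vol * Stress_tilde + eta * vol * (force). Integrating by parts and using the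
  positivity of eta, the equation follows at interior points; since the body is the closure of its
  interior, it extends to the boundary by continuity.

  Smoothness is handled pointwise: "smooth_on {x} f" means that f is smooth near x, and
  smoothness on S is the same as smoothness at every point of S.
*)
theory Submission
  imports Defs
begin

section \<open>Calculus of smooth functions\<close>

text \<open>The energy is evaluated through \<open>chart_at\<close>, whose choice may jump from
  point to point, so nothing about it is visibly smooth until the transformation law of \<Theta>
  shows that every chart gives the same pull-back. Variations, on the other hand, are families of
  maps into the manifold: the coordinate move has to be carried back through the chart and glued to
  \<open>y\<close>. The gluing is harmless because the bump function vanishes on an annulus where
  both formulas are valid.

  The body is merely a compact set, so the Leibniz rule is not applied to the integral over it. The
  change of the energy density is supported in a small ball; hence it may be integrated over a box
  instead, and it is smooth even at points of the box outside the body.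

  The logarithm in the stress comes from varying the volume density: the product rule gives
  \<open>vol\<close> times the derivative of \<open>F0\<close>, plus \<open>F0 + \<U>\<close> times
  the derivative of \<open>vol\<close>. Factoring out \<open>vol\<close> leaves the derivative of
  \<open>ln vol\<close> beside \<sigma>.\<close>

lemma frechet_derivative_cong_ev:
  assumes "eventually (\<lambda>x. f x = g x) (nhds x)"
  shows "frechet_derivative f (at x) = frechet_derivative g (at x)"
proof -
  \<comment> \<open>\<open>frechet_derivative\<close> is a Hilbert choice among the derivatives, so
    it is enough that both functions admit the same candidates; this covers points without any
    derivative as well.\<close>
  have "(f has_derivative f') (at x) \<longleftrightarrow> (g has_derivative f') (at x)" for f'
  proof -
    obtain S where S: "open S" "x \<in> S" "\<And>x. x \<in> S \<Longrightarrow> f x = g x"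
      using assms by (auto simp: eventually_nhds)
    then show ?thesis
      using has_derivative_transform_within_open[of f f' x UNIV S g]
        has_derivative_transform_within_open[of g f' x UNIV S f] by auto
  qed
  then show ?thesis by (simp add: frechet_derivative_def)
qed

lemma frechet_derivative_eqI:
  "(f has_derivative f') (at x) \<Longrightarrow> frechet_derivative f (at x) = f'"
  by (metis frechet_derivative_at)

section \<open>Closure rules for the classes C^k on open sets\<close>

lemma Ck_on_subset: "Ck_on k T f \<Longrightarrow> S \<subseteq> T \<Longrightarrow> Ck_on k S f"
  by (induction k arbitrary: f) (auto intro: continuous_on_subset)

lemma Ck_on_SucD: "Ck_on (Suc k) S f \<Longrightarrow> Ck_on k S f"
proof (induction k arbitrary: f)
  case 0
  then show ?case
    by (auto intro!: continuous_at_imp_continuous_on differentiable_imp_continuous_within)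
qed auto

text \<open>Openness turns equality on \<open>S\<close> into equality of germs at each point, which
  derivatives \<open>at x\<close> can see.\<close>

lemma Ck_on_cong:
  assumes "open S" "\<And>x. x \<in> S \<Longrightarrow> f x = g x" "Ck_on k S f"
  shows "Ck_on k S g"
  using assms(2,3)
proof (induction k arbitrary: f g)
  case 0
  then show ?case by (auto cong: continuous_on_cong)
next
  case (Suc k)
  have ev: "eventually (\<lambda>x. f x = g x) (nhds x)" if "x \<in> S" for x
    using assms(1) that Suc.prems(1) by (auto simp: eventually_nhds)
  have eq: "frechet_derivative f (at x) = frechet_derivative g (at x)" if "x \<in> S" for x
    using frechet_derivative_cong_ev[OF ev[OF that]] .
  have "g differentiable at x" if "x \<in> S" for x
    using Suc.prems(2) that has_derivative_transform_within_open[of f _ x UNIV, OF _ assms(1) that Suc.prems(1)]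
    unfolding differentiable_def Ck_on.simps by blast
  moreover have "Ck_on k S (\<lambda>x. frechet_derivative g (at x) v)" for v
    by (rule Suc.IH[of "\<lambda>x. frechet_derivative f (at x) v"]) (use Suc.prems(2) eq in auto)
  ultimately show ?case by simp
qed

text \<open>\<open>Ck_on\<close> speaks of the chosen derivative; here an explicit one takes its
  place, so that the differentiation rules can be fed in directly.\<close>

lemma Ck_on_SucI:
  assumes "open S" "\<And>x. x \<in> S \<Longrightarrow> (f has_derivative f' x) (at x)" "\<And>v. Ck_on k S (\<lambda>x. f' x v)"
  shows "Ck_on (Suc k) S f"
proof -
  have "Ck_on k S (\<lambda>x. frechet_derivative f (at x) v)" for v
    using assms by (intro Ck_on_cong[OF assms(1) _ assms(3)[of v]]) (metis frechet_derivative_eqI assms(2))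
  then show ?thesis using assms(2) by (auto simp: differentiable_def)
qed

lemma Ck_on_SucE:
  assumes "Ck_on (Suc k) S f" "x \<in> S"
  shows "(f has_derivative frechet_derivative f (at x)) (at x)"
  using assms by (simp add: frechet_derivative_works)

lemma Ck_on_Union:
  assumes "\<And>T. T \<in> \<T> \<Longrightarrow> open T \<and> Ck_on k T f"
  shows "Ck_on k (\<Union>\<T>) f"
  using assms
proof (induction k arbitrary: f)
  case 0
  then show ?case using continuous_on_open_Union[of \<T> f] by auto
qed auto

lemma Ck_on_const: "Ck_on k S (\<lambda>x. c)"
proof (induction k arbitrary: c)
  case (Suc k)
  then show ?case by (simp add: frechet_derivative_const)
qed auto

lemma Ck_on_bounded_linear: "bounded_linear f \<Longrightarrow> Ck_on k UNIV f"
proof (cases k)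
  case (Suc m)
  assume "bounded_linear f"
  then show ?thesis unfolding Suc
    by (intro Ck_on_SucI[where f' = "\<lambda>_. f"])
      (auto simp: bounded_linear_imp_has_derivative Ck_on_const)
qed (auto simp: linear_continuous_on)

lemma Ck_on_add:
  assumes "open S" "Ck_on k S f" "Ck_on k S g"
  shows "Ck_on k S (\<lambda>x. f x + g x)"
  using assms(2,3)
proof (induction k arbitrary: f g)
  case (Suc k)
  show ?case
    by (rule Ck_on_SucI[OF assms(1) has_derivative_add[OF Ck_on_SucE Ck_on_SucE]])
      (use Suc in auto)
qed (auto intro: continuous_intros)

lemma Ck_on_sum:
  assumes "open S" "\<And>i. i \<in> I \<Longrightarrow> Ck_on k S (f i)"
  shows "Ck_on k S (\<lambda>x. \<Sum>i\<in>I. f i x)"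
  using assms(2) by (induction I rule: infinite_finite_induct) (auto intro: Ck_on_const Ck_on_add[OF assms(1)])

text \<open>The product rule leaves two terms of the same bilinear shape, in which one factor is
  differentiated and the other merely drops one order; so the induction closes.\<close>

lemma Ck_on_bilinear:
  assumes "bounded_bilinear h" "open S" "Ck_on k S f" "Ck_on k S g"
  shows "Ck_on k S (\<lambda>x. h (f x) (g x))"
  using assms(3,4)
proof (induction k arbitrary: f g)
  case 0
  then show ?case using bounded_bilinear.continuous_on[OF assms(1)] by auto
next
  case (Suc k)
  show ?case
    by (rule Ck_on_SucI[OF assms(2) bounded_bilinear.FDERIV[OF assms(1) Ck_on_SucE Ck_on_SucE]])
      (use Suc.prems Ck_on_SucD[OF Suc.prems(1)] Ck_on_SucD[OF Suc.prems(2)] in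
        \<open>auto intro!: Ck_on_add[OF assms(2)] Suc.IH\<close>)
qed

lemma Ck_on_bounded_linear_compose:
  assumes "bounded_linear L" "open S" "Ck_on k S f"
  shows "Ck_on k S (\<lambda>x. L (f x))"
  using assms(3)
proof (induction k arbitrary: f)
  case 0
  then show ?case using bounded_linear.continuous_on[OF assms(1)] by auto
next
  case (Suc k)
  show ?case
    by (rule Ck_on_SucI[OF assms(2) bounded_linear.has_derivative[OF assms(1) Ck_on_SucE]])
      (use Suc in auto)
qed

text \<open>The chain rule differentiates \<open>g\<close> in a direction that varies with
  \<open>x\<close>, while \<open>Ck_on\<close> controls fixed directions only. Expanding the
  direction in \<open>Basis\<close> leaves scalar coefficients times derivatives of \<open>g\<close>
  in fixed directions, hence the Euclidean intermediate space.\<close>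

lemma Ck_on_compose:
  fixes f :: "'a::real_normed_vector \<Rightarrow> 'b::euclidean_space" and g :: "'b \<Rightarrow> 'c::real_normed_vector"
  assumes "open S" "f ` S \<subseteq> T" "Ck_on k S f" "Ck_on k T g"
  shows "Ck_on k S (\<lambda>x. g (f x))"
  using assms(3,4)
proof (induction k arbitrary: g)
  case 0
  then show ?case using continuous_on_compose2[of T g S f] assms(2) by auto
next
  case (Suc k)
  let ?g' = "\<lambda>y. frechet_derivative g (at y)"
  have d: "((\<lambda>x. g (f x)) has_derivative
      (\<lambda>v. \<Sum>b\<in>Basis. (frechet_derivative f (at x) v \<bullet> b) *\<^sub>R ?g' (f x) b)) (at x)"
    if x: "x \<in> S" for x
  proof -
    have g: "(g has_derivative ?g' (f x)) (at (f x))"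
      using Suc.prems(2) assms(2) x by (intro Ck_on_SucE) auto
    have eq: "?g' (f x) w = (\<Sum>b\<in>Basis. (w \<bullet> b) *\<^sub>R ?g' (f x) b)" for w
      using linear_sum[OF has_derivative_linear[OF g], of "\<lambda>b. (w \<bullet> b) *\<^sub>R b" Basis]
      unfolding euclidean_representation linear_cmul[OF has_derivative_linear[OF g]] .
    then show ?thesis
      using has_derivative_compose[OF Ck_on_SucE[OF Suc.prems(1) x] g]
      by (subst (asm) eq)
  qed
  have g': "Ck_on k S (\<lambda>x. ?g' (f x) b)" for b
    by (rule Suc.IH[OF Ck_on_SucD[OF Suc.prems(1)]]) (use Suc.prems(2) in simp)
  have f': "Ck_on k S (\<lambda>x. frechet_derivative f (at x) v \<bullet> b)" for v b
    by (rule Ck_on_bounded_linear_compose[OF bounded_linear_inner_left assms(1)])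
      (use Suc.prems(1) in simp)
  show ?case
  proof (rule Ck_on_SucI[OF assms(1)])
    show "Ck_on k S (\<lambda>x. \<Sum>b\<in>Basis. (frechet_derivative f (at x) v \<bullet> b) *\<^sub>R ?g' (f x) b)" for v
      by (rule Ck_on_sum[OF assms(1)], rule Ck_on_bilinear[OF bounded_bilinear_scaleR assms(1) f' g'])
  qed (rule d)
qed

lemma Ck_on_inverse: "Ck_on k (- {0 :: real}) inverse"
proof (induction k)
  case 0
  then show ?case by (auto intro: continuous_intros)
next
  case (Suc k)
  show ?case
    by (rule Ck_on_SucI[where f' = "\<lambda>x v. - (inverse x * v * inverse x)"])
      (auto intro!: Ck_on_bounded_linear_compose[OF bounded_linear_minus[OF bounded_linear_ident]]
        Ck_on_bilinear[OF bounded_bilinear_mult] Suc Ck_on_const has_derivative_inverse')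
qed

section \<open>Smoothness as a local property, and its closure rules\<close>

lemma smooth_onE:
  assumes "smooth_on S f"
  obtains T where "open T" "S \<subseteq> T" "\<And>k. Ck_on k T f"
  using assms by (auto simp: smooth_on_def)

text \<open>A neighbourhood witnessing smoothness at a point serves all orders at once, so the union
  of all such neighbourhoods is again a witness.\<close>

lemma smooth_on_pointwise: "smooth_on S f \<longleftrightarrow> (\<forall>x\<in>S. smooth_on {x} f)"
proof
  assume *: "\<forall>x\<in>S. smooth_on {x} f"
  define \<T> where "\<T> = {T. open T \<and> (\<forall>k. Ck_on k T f)}"
  have "open (\<Union>\<T>)" "S \<subseteq> \<Union>\<T>"
    using * by (auto simp: \<T>_def smooth_on_def)
  moreover have "Ck_on k (\<Union>\<T>) f" for k
    by (rule Ck_on_Union) (auto simp: \<T>_def)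
  ultimately show "smooth_on S f" by (auto simp: smooth_on_def)
qed (auto simp: smooth_on_def)

lemma smooth_onI: "(\<And>x. x \<in> S \<Longrightarrow> smooth_on {x} f) \<Longrightarrow> smooth_on S f"
  using smooth_on_pointwise by blast

lemma smooth_onD: "smooth_on S f \<Longrightarrow> x \<in> S \<Longrightarrow> smooth_on {x} f"
  using smooth_on_pointwise by blast

lemma smooth_on_eventually:
  assumes "smooth_on {x} f" shows "eventually (\<lambda>z. smooth_on {z} f) (nhds x)"
proof -
  obtain T where "open T" "x \<in> T" "\<And>k. Ck_on k T f"
    using assms by (auto elim: smooth_onE)
  then show ?thesis by (auto simp: eventually_nhds smooth_on_def)
qed

lemma smooth_on_cong_ev:
  assumes "smooth_on {x} f" "eventually (\<lambda>x. f x = g x) (nhds x)"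
  shows "smooth_on {x} g"
proof -
  obtain T where T: "open T" "x \<in> T" "\<And>k. Ck_on k T f"
    using assms(1) by (auto elim: smooth_onE)
  obtain S where S: "open S" "x \<in> S" "\<And>x. x \<in> S \<Longrightarrow> f x = g x"
    using assms(2) by (auto simp: eventually_nhds)
  have "Ck_on k (S \<inter> T) g" for k
    using T S by (intro Ck_on_cong[OF _ _ Ck_on_subset[OF T(3)]]) auto
  then show ?thesis using T S unfolding smooth_on_def by (intro exI[of _ "S \<inter> T"]) auto
qed

lemma smooth_on_differentiable: "smooth_on S f \<Longrightarrow> x \<in> S \<Longrightarrow> f differentiable (at x)"
  by (erule smooth_onE) (metis Ck_on.simps(2) subsetD)

lemma smooth_on_has_derivative:
  "smooth_on S f \<Longrightarrow> x \<in> S \<Longrightarrow> (f has_derivative frechet_derivative f (at x)) (at x)"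
  using smooth_on_differentiable frechet_derivative_works by blast

lemma smooth_on_isCont: "smooth_on S f \<Longrightarrow> x \<in> S \<Longrightarrow> isCont f x"
  by (simp add: differentiable_imp_continuous_within smooth_on_differentiable)

lemma smooth_on_continuous_on: "smooth_on S f \<Longrightarrow> continuous_on S f"
  using smooth_on_isCont continuous_at_imp_continuous_on by blast

named_theorems smooth_intros

lemma smooth_on_const [smooth_intros]: "smooth_on S (\<lambda>x. c)"
  unfolding smooth_on_def by (rule exI[of _ UNIV]) (auto intro: Ck_on_const)

lemma smooth_on_bounded_linear: "bounded_linear f \<Longrightarrow> smooth_on S f"
  unfolding smooth_on_def by (rule exI[of _ UNIV]) (auto intro: Ck_on_bounded_linear)

lemma smooth_on_bounded_linear_compose:
  "bounded_linear L \<Longrightarrow> smooth_on S f \<Longrightarrow> smooth_on S (\<lambda>x. L (f x))"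
  by (erule smooth_onE) (auto simp: smooth_on_def intro: Ck_on_bounded_linear_compose)

lemmas smooth_on_ident [smooth_intros] = smooth_on_bounded_linear[OF bounded_linear_ident]
lemmas smooth_on_fst [smooth_intros] = smooth_on_bounded_linear_compose[OF bounded_linear_fst]
lemmas smooth_on_snd [smooth_intros] = smooth_on_bounded_linear_compose[OF bounded_linear_snd]
lemmas smooth_on_vec_nth [smooth_intros] = smooth_on_bounded_linear_compose[OF bounded_linear_vec_nth]

lemma smooth_on_derivative [smooth_intros]:
  "smooth_on S f \<Longrightarrow> smooth_on S (\<lambda>x. frechet_derivative f (at x) v)"
proof -
  assume "smooth_on S f"
  then obtain T where T: "open T" "S \<subseteq> T" "\<And>k. Ck_on k T f" by (auto elim: smooth_onE)
  have "Ck_on k T (\<lambda>x. frechet_derivative f (at x) v)" for k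
    using T(3)[of "Suc k"] by simp
  then show ?thesis using T unfolding smooth_on_def by blast
qed

lemma smooth_on_pd [smooth_intros]: "smooth_on S f \<Longrightarrow> smooth_on S (pd i f)"
  using smooth_on_derivative[of S f "axis i 1"] by (simp add: pd_def[abs_def])

lemma smooth_on_bilinear:
  assumes "bounded_bilinear h" "smooth_on S f" "smooth_on S g"
  shows "smooth_on S (\<lambda>x. h (f x) (g x))"
proof -
  obtain T U where "open T" "S \<subseteq> T" "\<And>k. Ck_on k T f" "open U" "S \<subseteq> U" "\<And>k. Ck_on k U g"
    using assms(2,3) by (metis smooth_onE)
  then show ?thesis unfolding smooth_on_def
    by (intro exI[of _ "T \<inter> U"]) (auto intro!: Ck_on_bilinear[OF assms(1)] intro: Ck_on_subset[of _ T f] Ck_on_subset[of _ U g])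
qed

lemmas smooth_on_mult [smooth_intros] = smooth_on_bilinear[OF bounded_bilinear_mult]
lemmas smooth_on_scaleR [smooth_intros] = smooth_on_bilinear[OF bounded_bilinear_scaleR]
lemmas smooth_on_inner [smooth_intros] = smooth_on_bilinear[OF bounded_bilinear_inner]

lemma smooth_on_add [smooth_intros]:
  assumes "smooth_on S f" "smooth_on S g"
  shows "smooth_on S (\<lambda>x. f x + g x)"
proof -
  obtain T U where "open T" "S \<subseteq> T" "\<And>k. Ck_on k T f" "open U" "S \<subseteq> U" "\<And>k. Ck_on k U g"
    using assms by (metis smooth_onE)
  then show ?thesis unfolding smooth_on_def
    by (intro exI[of _ "T \<inter> U"]) (auto intro!: Ck_on_add intro: Ck_on_subset[of _ T f] Ck_on_subset[of _ U g])
qed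

lemma smooth_on_minus [smooth_intros]:
  "smooth_on S f \<Longrightarrow> smooth_on S (\<lambda>x. - f x)"
  by (rule smooth_on_bounded_linear_compose[OF bounded_linear_minus[OF bounded_linear_ident]])

lemma smooth_on_diff [smooth_intros]:
  "smooth_on S f \<Longrightarrow> smooth_on S g \<Longrightarrow> smooth_on S (\<lambda>x. f x - g x)"
  using smooth_on_add[of S f "\<lambda>x. - g x"] smooth_on_minus[of S g] by simp

lemma smooth_on_sum [smooth_intros]:
  "(\<And>i. i \<in> I \<Longrightarrow> smooth_on S (f i)) \<Longrightarrow> smooth_on S (\<lambda>x. \<Sum>i\<in>I. f i x)"
  by (induction I rule: infinite_finite_induct) (auto intro: smooth_intros)

lemma smooth_on_prod [smooth_intros]:
  fixes f :: "'i \<Rightarrow> 'a::real_normed_vector \<Rightarrow> real"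
  shows "(\<And>i. i \<in> I \<Longrightarrow> smooth_on S (f i)) \<Longrightarrow> smooth_on S (\<lambda>x. \<Prod>i\<in>I. f i x)"
  by (induction I rule: infinite_finite_induct) (auto intro: smooth_intros)

lemma smooth_on_Pair [smooth_intros]:
  assumes "smooth_on S f" "smooth_on S g"
  shows "smooth_on S (\<lambda>x. (f x, g x))"
proof -
  have "smooth_on S (\<lambda>x. (f x, 0) + (0, g x))"
    by (intro smooth_on_add smooth_on_bounded_linear_compose[OF _ assms(1)]
          smooth_on_bounded_linear_compose[OF _ assms(2)]
          bounded_linear_Pair bounded_linear_ident bounded_linear_zero)
  then show ?thesis by simp
qed

lemma smooth_on_vec_lambda [smooth_intros]:
  fixes f :: "'i::finite \<Rightarrow> 'a::real_normed_vector \<Rightarrow> real"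
  assumes "\<And>i. smooth_on S (f i)"
  shows "smooth_on S (\<lambda>x. \<chi> i. f i x)"
proof -
  have "(\<chi> i. f i x) = (\<Sum>i\<in>UNIV. f i x *\<^sub>R axis i 1)" for x
    by (simp add: vec_eq_iff axis_def sum.delta' if_distrib cong: if_cong)
  then show ?thesis using assms by (auto intro!: smooth_intros)
qed

lemma smooth_on_compose:
  fixes f :: "'a::real_normed_vector \<Rightarrow> 'b::euclidean_space"
  assumes "smooth_on S f" "smooth_on (f ` S) g"
  shows "smooth_on S (\<lambda>x. g (f x))"
proof -
  obtain T where T: "open T" "S \<subseteq> T" "\<And>k. Ck_on k T f" using assms(1) by (auto elim: smooth_onE)
  obtain U where U: "open U" "f ` S \<subseteq> U" "\<And>k. Ck_on k U g" using assms(2) by (auto elim: smooth_onE)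
  have op: "open (T \<inter> f -` U)"
    using T(1) T(3)[of 0] U(1) by (simp add: continuous_on_open_vimage Int_commute)
  have "Ck_on k (T \<inter> f -` U) (\<lambda>x. g (f x))" for k
    by (rule Ck_on_compose[OF op _ Ck_on_subset[OF T(3)] U(3)]) auto
  then show ?thesis using T(2) U(2) op unfolding smooth_on_def
    by (intro exI[of _ "T \<inter> f -` U"]) auto
qed

lemma smooth_on_compose_at:
  fixes f :: "'a::real_normed_vector \<Rightarrow> 'b::euclidean_space"
  shows "smooth_on {f x} g \<Longrightarrow> smooth_on {x} f \<Longrightarrow> smooth_on {x} (\<lambda>x. g (f x))"
  by (rule smooth_on_compose) auto

lemma smooth_on_inverse:
  fixes f :: "'a::real_normed_vector \<Rightarrow> real"
  assumes "smooth_on {x} f" "f x \<noteq> 0"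
  shows "smooth_on {x} (\<lambda>x. inverse (f x))"
proof (rule smooth_on_compose_at[OF _ assms(1)])
  show "smooth_on {f x} inverse"
    unfolding smooth_on_def using assms(2) Ck_on_inverse by (intro exI[of _ "- {0}"]) auto
qed

section \<open>Partial derivatives\<close>

lemma frechet_derivative_eq_sum_pd:
  fixes f :: "real^'k::finite \<Rightarrow> 'b::real_normed_vector"
  assumes "f differentiable (at x)"
  shows "frechet_derivative f (at x) v = (\<Sum>i\<in>UNIV. v $ i *\<^sub>R pd i f x)"
proof -
  interpret linear "frechet_derivative f (at x)"
    using assms by (rule linear_frechet_derivative)
  have "v = (\<Sum>i\<in>UNIV. v $ i *\<^sub>R axis i 1)"
    by (simp add: vec_eq_iff axis_def sum.delta' if_distrib cong: if_cong)
  then have "frechet_derivative f (at x) v = frechet_derivative f (at x) (\<Sum>i\<in>UNIV. v $ i *\<^sub>R axis i 1)"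
    by simp
  also have "\<dots> = (\<Sum>i\<in>UNIV. v $ i *\<^sub>R pd i f x)"
    by (simp add: sum scaleR pd_def)
  finally show ?thesis .
qed

lemma pd_cong_ev:
  "eventually (\<lambda>x. f x = g x) (nhds x) \<Longrightarrow> pd i f x = pd i g x"
  unfolding pd_def using frechet_derivative_cong_ev[of f g x] by simp

lemma pd_eqI: "(f has_derivative f') (at x) \<Longrightarrow> pd i f x = f' (axis i 1)"
  by (simp add: pd_def frechet_derivative_eqI)

section \<open>Bump functions\<close>

text \<open>The classical exp(-1/t) extended by 0. The extra power of 1/t makes the family closed
  under differentiation, so one induction over all \<open>k\<close> gives smoothness.\<close>

definition flat :: "nat \<Rightarrow> real \<Rightarrow> real" where
  "flat k t = (if t \<le> 0 then 0 else exp (- inverse t) * inverse t ^ k)"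

lemma flat_has_derivative:
  "(flat k has_real_derivative flat (k + 2) t - k * flat (k + 1) t) (at t)"
proof -
  consider "t < 0" | "t > 0" | "t = 0" by linarith
  then show ?thesis
  proof cases
    case 1
    have "((\<lambda>_. 0) has_real_derivative 0) (at t)" by simp
    then have "(flat k has_real_derivative 0) (at t)"
      by (rule has_field_derivative_transform_within_open[of _ _ _ "{..<0}"])
        (use 1 in \<open>auto simp: flat_def\<close>)
    then show ?thesis using 1 by (simp add: flat_def)
  next
    case 2
    have "((\<lambda>t. exp (- inverse t) * inverse t ^ k) has_real_derivative
        flat (k + 2) t - k * flat (k + 1) t) (at t)"
      using 2 by (auto intro!: derivative_eq_intros simp: flat_def algebra_simps)
        (cases k, auto simp: algebra_simps)
    then show ?thesis
      by (rule has_field_derivative_transform_within_open[of _ _ _ "{0<..}"])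
        (use 2 in \<open>auto simp: flat_def\<close>)
  next
    case 3
    \<comment> \<open>With x = 1/h this is the difference quotient of \<open>flat k\<close> at 0
      from the right; from the left the quotient is 0.\<close>
    have "((\<lambda>x. x ^ Suc k / exp x) \<longlongrightarrow> (0 :: real)) at_top"
      by (rule tendsto_power_div_exp_0)
    then have "((\<lambda>h. inverse h ^ Suc k / exp (inverse h)) \<longlongrightarrow> (0 :: real)) (at_right 0)"
      by (rule filterlim_compose[OF _ filterlim_inverse_at_top_right])
    then have R: "((\<lambda>h. flat k h / h) \<longlongrightarrow> 0) (at_right 0)"
      by (rule Lim_transform_eventually)
        (auto simp: eventually_at_right_less flat_def exp_minus field_simps intro!: eventually_at_rightI[of 0 1])
    have L: "((\<lambda>h. flat k h / h) \<longlongrightarrow> 0) (at_left 0)"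
      by (rule Lim_transform_eventually[OF tendsto_const])
        (auto simp: flat_def intro!: eventually_at_leftI[of "-1"])
    have "((\<lambda>h. flat k h / h) \<longlongrightarrow> 0) (at 0)"
      using L R by (simp add: filterlim_at_split)
    then show ?thesis using 3 by (simp add: has_field_derivative_iff flat_def)
  qed
qed

lemma smooth_on_flat: "smooth_on S (flat k)"
proof -
  have "Ck_on n UNIV (flat k)" for n
  proof (induction n arbitrary: k)
    case 0
    then show ?case
      by (auto intro!: continuous_at_imp_continuous_on DERIV_isCont[OF flat_has_derivative])
  next
    case (Suc n)
    have *: "Ck_on n UNIV (\<lambda>t. (flat (k + 2) t + (- real k) * flat (k + 1) t) * v)" for v
      by (intro Ck_on_bilinear[OF bounded_bilinear_mult] Ck_on_add Suc Ck_on_const) auto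
    show ?case
      by (rule Ck_on_SucI[where f' = "\<lambda>t v. (flat (k + 2) t + (- real k) * flat (k + 1) t) * v"])
        (use flat_has_derivative[of k] * in \<open>auto simp: has_field_derivative_def\<close>)
  qed
  then show ?thesis unfolding smooth_on_def by (intro exI[of _ UNIV]) auto
qed

text \<open>The bound by 1 lets the size of a coordinate move be controlled by the parameter alone,
  uniformly over the support.\<close>

lemma bump_function_exists:
  fixes c :: "'a::euclidean_space"
  assumes "s > 0"
  obtains \<eta> :: "'a \<Rightarrow> real" where "smooth_on UNIV \<eta>" "\<And>x. 0 \<le> \<eta> x" "\<And>x. \<eta> x \<le> 1"
    "\<eta> c > 0" "\<And>x. x \<notin> cball c s \<Longrightarrow> \<eta> x = 0"
proof
  \<comment> \<open>The squared distance is written as an inner product because that is polynomial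
    in \<open>x\<close>, whereas the norm is not differentiable at \<open>c\<close>.\<close>
  let ?\<eta> = "\<lambda>x. flat 0 (s\<^sup>2 - (x - c) \<bullet> (x - c))"
  show "smooth_on UNIV ?\<eta>"
    by (rule smooth_onI, rule smooth_on_compose_at[OF smooth_on_flat]) (intro smooth_intros)
  show "0 \<le> ?\<eta> x" "?\<eta> x \<le> 1" for x by (auto simp: flat_def)
  show "?\<eta> c > 0" using assms by (auto simp: flat_def)
  fix x assume "x \<notin> cball c s"
  then have "s\<^sup>2 < (norm (x - c))\<^sup>2"
    using assms by (intro power_strict_mono) (auto simp: dist_norm norm_minus_commute)
  then show "?\<eta> x = 0" by (simp add: flat_def power2_norm_eq_inner)
qed

section \<open>Integration\<close>

text \<open>The tube lemma: compactness of the box gives one radius for all its points. Later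
  integrands are checked only at parameter 0, but the Leibniz rule needs an interval of
  parameters.\<close>

lemma smooth_on_tube:
  fixes G :: "real \<times> 'a::euclidean_space \<Rightarrow> 'b::real_normed_vector"
  assumes "smooth_on ({0} \<times> cbox a b) G"
  obtains e where "e > 0" "smooth_on ({-e<..<e} \<times> cbox a b) G"
proof -
  obtain T where T: "open T" "{0} \<times> cbox a b \<subseteq> T" "\<And>k. Ck_on k T G"
    using assms by (auto elim: smooth_onE)
  obtain e where e: "e > 0" "(\<Union>z\<in>{0} \<times> cbox a b. ball z e) \<subseteq> T"
    using compact_subset_open_imp_ball_epsilon_subset[OF compact_Times[OF _ compact_cbox] T(1,2)]
    by (metis compact_insert compact_empty)
  have "(\<epsilon>, x) \<in> T" if "\<epsilon> \<in> {-e<..<e}" "x \<in> cbox a b" for \<epsilon> x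
  proof -
    have "(\<epsilon>, x) \<in> ball (0, x) e" using that by (auto simp: dist_Pair_Pair)
    then show ?thesis using e(2) that by blast
  qed
  then have "smooth_on ({-e<..<e} \<times> cbox a b) G"
    using T(1,3) unfolding smooth_on_def by (intro exI[of _ T]) auto
  then show thesis using that e(1) by blast
qed

text \<open>The parameter derivative is jointly continuous on a slab around 0, so the Leibniz rule
  applies there; \<open>g\<close> only has to match it at 0. The second claim later justifies
  splitting the energy for small parameters.\<close>

lemma has_real_derivative_integral_cbox:
  fixes G :: "real \<times> 'a::euclidean_space \<Rightarrow> real"
  assumes G: "smooth_on ({0} \<times> cbox a b) G"
    and g: "\<And>x. x \<in> cbox a b \<Longrightarrow> ((\<lambda>\<epsilon>. G (\<epsilon>, x)) has_real_derivative g x) (at 0)"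
  shows "((\<lambda>\<epsilon>. integral (cbox a b) (\<lambda>x. G (\<epsilon>, x))) has_real_derivative integral (cbox a b) g) (at 0)"
    and "eventually (\<lambda>\<epsilon>. (\<lambda>x. G (\<epsilon>, x)) integrable_on cbox a b) (nhds 0)"
proof -
  obtain e where e: "e > 0" and sm: "smooth_on ({-e<..<e} \<times> cbox a b) G"
    using smooth_on_tube[OF G] .
  let ?I = "{-e<..<e}" and ?D = "\<lambda>\<epsilon> x. frechet_derivative G (at (\<epsilon>, x)) (1, 0)"
  have d: "((\<lambda>\<epsilon>. G (\<epsilon>, x)) has_real_derivative ?D \<epsilon> x) (at \<epsilon>)" if "\<epsilon> \<in> ?I" "x \<in> cbox a b" for \<epsilon> x
  proof -
    let ?F = "frechet_derivative G (at (\<epsilon>, x))"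
    have F: "(G has_derivative ?F) (at (\<epsilon>, x))"
      using smooth_on_has_derivative[OF sm] that by simp
    have "((\<lambda>\<epsilon>. (\<epsilon>, x)) has_derivative (\<lambda>h. (h, 0))) (at \<epsilon>)"
      by (auto intro!: derivative_eq_intros)
    from has_derivative_compose[OF this F]
    have "((\<lambda>\<epsilon>. G (\<epsilon>, x)) has_derivative (\<lambda>h. ?F (h, 0))) (at \<epsilon>)" .
    moreover have "(\<lambda>h. ?F (h, 0)) = (*) (?D \<epsilon> x)"
    proof
      fix h show "?F (h, 0) = ?D \<epsilon> x * h"
        using linear_cmul[OF has_derivative_linear[OF F], of h "(1, 0)"] by (simp add: mult.commute)
    qed
    ultimately show ?thesis unfolding has_field_derivative_def by (rule back_subst)
  qed
  have "continuous_on (?I \<times> cbox a b) (\<lambda>z. frechet_derivative G (at z) (1, 0))"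
    by (rule smooth_on_continuous_on[OF smooth_on_derivative[OF sm]])
  then have cont: "continuous_on (?I \<times> cbox a b) (\<lambda>(\<epsilon>, x). ?D \<epsilon> x)"
    by (simp add: case_prod_unfold)
  have int: "(\<lambda>x. G (\<epsilon>, x)) integrable_on cbox a b" if "\<epsilon> \<in> ?I" for \<epsilon>
    by (rule integrable_continuous, rule continuous_on_compose2[OF smooth_on_continuous_on[OF sm]])
      (use that in \<open>auto intro: continuous_intros\<close>)
  then show "eventually (\<lambda>\<epsilon>. (\<lambda>x. G (\<epsilon>, x)) integrable_on cbox a b) (nhds 0)"
    using e unfolding eventually_nhds by (intro exI[of _ ?I]) auto
  have "((\<lambda>\<epsilon>. integral (cbox a b) (\<lambda>x. G (\<epsilon>, x))) has_real_derivative integral (cbox a b) (?D 0)) (at 0 within ?I)"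
    by (rule leibniz_rule_field_derivative[OF _ int cont])
      (use e d in \<open>auto intro: has_field_derivative_at_within\<close>)
  moreover have "at 0 within ?I = at (0::real)"
    using e by (intro at_within_open) auto
  moreover have "integral (cbox a b) (?D 0) = integral (cbox a b) g"
    by (rule integral_cong, rule DERIV_unique[OF d g]) (use e in auto)
  ultimately show "((\<lambda>\<epsilon>. integral (cbox a b) (\<lambda>x. G (\<epsilon>, x))) has_real_derivative integral (cbox a b) g) (at 0)"
    by simp
qed

lemma has_real_derivative_line:
  fixes f :: "real^'k::finite \<Rightarrow> real"
  assumes "f differentiable (at x)"
  shows "((\<lambda>\<epsilon>. f (x + (\<epsilon> * v) *\<^sub>R axis i 1)) has_real_derivative v * pd i f x) (at 0)"
proof -
  let ?F = "frechet_derivative f (at x)"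
  have F: "(f has_derivative ?F) (at (x + (0 * v) *\<^sub>R axis i 1))"
    using assms by (simp add: frechet_derivative_works)
  have "((\<lambda>\<epsilon>. x + (\<epsilon> * v) *\<^sub>R axis i 1) has_derivative (\<lambda>h. (h * v) *\<^sub>R axis i 1)) (at 0)"
    by (auto intro!: derivative_eq_intros)
  from has_derivative_compose[OF this F]
  have "((\<lambda>\<epsilon>. f (x + (\<epsilon> * v) *\<^sub>R axis i 1)) has_derivative (\<lambda>h. ?F ((h * v) *\<^sub>R axis i 1))) (at 0)" .
  then show ?thesis
    by (simp add: has_field_derivative_def pd_def linear_cmul[OF has_derivative_linear[OF F]]
        mult.assoc mult.commute fun_eq_iff) (simp add: mult_commute_abs)
qed

text \<open>By translation invariance the integral of \<open>h (x + \<epsilon> e\<^sub>i)\<close> does not depend on \<open>\<epsilon>\<close>; differentiate at \<open>0\<close>.\<close>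

lemma integral_pd_eq_0:
  fixes h :: "real^'d::finite \<Rightarrow> real"
  assumes h: "smooth_on UNIV h" and supp: "\<And>x. x \<notin> cball c s \<Longrightarrow> h x = 0"
    and box: "cball c (s + 1) \<subseteq> cbox a b"
  shows "integral (cbox a b) (pd i h) = 0"
proof -
  let ?I = "\<lambda>\<epsilon>::real. integral (cbox a b) (\<lambda>x. h (x + (\<epsilon> * 1) *\<^sub>R axis i 1))"
  \<comment> \<open>The margin 1 of the box keeps the support inside it under every translation by a
    vector of norm below 1.\<close>
  have supp': "h (x + v) = 0" if "x \<notin> cbox a b" "norm v < 1" for x v
  proof (rule supp)
    have "dist c x \<le> dist c (x + v) + norm v"
      using dist_triangle[of c x "x + v"] by (simp add: dist_norm)
    then show "x + v \<notin> cball c s" using that box by (auto simp: subset_iff)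
  qed
  have cont: "continuous_on S (\<lambda>x. h (x + v))" for S v
    by (intro continuous_on_compose2[OF smooth_on_continuous_on[OF h]] continuous_intros) auto
  have const: "?I \<epsilon> = integral (cbox a b) h" if "\<epsilon> \<in> {-1<..<1}" for \<epsilon>
  proof -
    let ?v = "(\<epsilon> * 1) *\<^sub>R axis i 1 :: real^'d"
    have v: "norm ?v < 1" using that by (auto simp: norm_axis_1)
    have "(h has_integral integral (cbox a b) h) (cbox a b)"
      using cont[of _ 0] by (intro integrable_integral integrable_continuous) simp
    then have "((\<lambda>x. h (x + ?v)) has_integral integral (cbox a b) h) (cbox (a - ?v) (b - ?v))"
      by (rule has_integral_shift_cbox)
    \<comment> \<open>The substitution moves the box too, but the old and the new box both contain
      the support of the translate; the two integrals are compared over the whole space.\<close>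
    then have "((\<lambda>x. h (x + ?v)) has_integral integral (cbox a b) h) UNIV"
      by (rule has_integral_on_superset)
        (use supp'[of "_ + ?v" 0]in \<open>auto simp: mem_box algebra_simps\<close>)
    moreover have "((\<lambda>x. h (x + ?v)) has_integral ?I \<epsilon>) UNIV"
      by (rule has_integral_on_superset[OF integrable_integral[OF integrable_continuous[OF cont]]])
        (use supp' v in auto)
    ultimately show ?thesis by (rule has_integral_unique[symmetric])
  qed
  have "(?I has_real_derivative 0) (at 0)"
    by (rule has_field_derivative_transform_within_open[OF DERIV_const, of "{-1<..<1}"])
      (use const in auto)
  moreover have "(?I has_real_derivative integral (cbox a b) (pd i h)) (at 0)"
  proof -
    let ?G = "\<lambda>z. h (snd z + (fst z * 1) *\<^sub>R axis i 1)"
    have "smooth_on {z} ?G" for z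
      by (rule smooth_on_compose_at[OF smooth_onD[OF h]]) (auto intro!: smooth_intros)
    moreover have "((\<lambda>\<epsilon>. ?G (\<epsilon>, x)) has_real_derivative pd i h x) (at 0)" for x
      using has_real_derivative_line[of h x 1 i] smooth_on_differentiable[OF h] by simp
    ultimately show ?thesis
      using has_real_derivative_integral_cbox(1)[of a b ?G "pd i h"] by (simp add: smooth_onI)
  qed
  ultimately show ?thesis using DERIV_unique by blast
qed

text \<open>The body need not be a box, so gauge integrability is obtained from Lebesgue
  integrability.\<close>

lemma continuous_on_compact_integrable_on:
  fixes f :: "'a::euclidean_space \<Rightarrow> real"
  assumes "compact S" "continuous_on S f"
  shows "f integrable_on S"
  using borel_integrable_compact[OF assms]
    set_borel_integral_eq_integral(1)[of S f] by (simp add: set_integrable_def)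

section \<open>Maps into a manifold\<close>

lemma smooth_atlasD:
  assumes "smooth_atlas \<A>" "(U, \<phi>) \<in> \<A>"
  shows "open U" "open (\<phi> ` U)" "homeomorphism U (\<phi> ` U) \<phi> (inv_into U \<phi>)"
    "inj_on \<phi> U" "continuous_on U \<phi>"
  using assms unfolding smooth_atlas_def
  by (fastforce intro: inj_on_inverseI simp: homeomorphism_def)+

lemma chart_at:
  assumes "smooth_atlas \<A>"
  shows "chart_at \<A> m \<in> \<A>" "m \<in> fst (chart_at \<A> m)"
proof -
  have "m \<in> (\<Union>(U, \<phi>)\<in>\<A>. U)" using assms by (simp add: smooth_atlas_def)
  then have "\<exists>c. c \<in> \<A> \<and> m \<in> fst c" by force
  from someI_ex[OF this] show "chart_at \<A> m \<in> \<A>" "m \<in> fst (chart_at \<A> m)"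
    by (auto simp: chart_at_def)
qed

lemma smooth_into_pointwise:
  "smooth_into \<A> S y \<longleftrightarrow> (\<forall>x\<in>S. smooth_into \<A> {x} y)"
proof
  assume "smooth_into \<A> S y"
  then show "\<forall>x\<in>S. smooth_into \<A> {x} y" unfolding smooth_into_def by blast
next
  assume *: "\<forall>x\<in>S. smooth_into \<A> {x} y"
  define \<T> where "\<T> = {T. open T \<and> continuous_on T y \<and> (\<forall>(U, \<phi>)\<in>\<A>. smooth_on (T \<inter> y -` U) (\<phi> \<circ> y))}"
  have "open (\<Union>\<T>)" "S \<subseteq> \<Union>\<T>"
    using * by (auto simp: \<T>_def smooth_into_def)
  moreover have "continuous_on (\<Union>\<T>) y"
    by (rule continuous_on_open_Union) (auto simp: \<T>_def)
  moreover have "smooth_on (\<Union>\<T> \<inter> y -` U) (\<phi> \<circ> y)" if c: "(U, \<phi>) \<in> \<A>" for U \<phi>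
  proof (rule smooth_onI)
    fix x assume "x \<in> \<Union>\<T> \<inter> y -` U"
    then obtain T where "T \<in> \<T>" "x \<in> T \<inter> y -` U" by auto
    then show "smooth_on {x} (\<phi> \<circ> y)" using c unfolding \<T>_def by (blast intro: smooth_onD)
  qed
  ultimately show "smooth_into \<A> S y" unfolding smooth_into_def by blast
qed

text \<open>A form without preimage sets: near \<open>x\<close> each point is tested in the charts
  around its own image. Gluing and composition are proved in this form.\<close>

lemma smooth_into_at_iff:
  assumes "smooth_atlas \<A>"
  shows "smooth_into \<A> {x} y \<longleftrightarrow>
    (\<exists>T. open T \<and> x \<in> T \<and> (\<forall>z\<in>T. isCont y z \<and> (\<forall>(U, \<phi>)\<in>\<A>. y z \<in> U \<longrightarrow> smooth_on {z} (\<phi> \<circ> y))))"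
    (is "_ \<longleftrightarrow> (\<exists>T. ?P T)")
proof
  assume "smooth_into \<A> {x} y"
  then obtain T where T: "open T" "x \<in> T" "continuous_on T y"
    "\<forall>(U, \<phi>)\<in>\<A>. smooth_on (T \<inter> y -` U) (\<phi> \<circ> y)"
    by (auto simp: smooth_into_def)
  then have "?P T"
    by (auto simp: continuous_on_eq_continuous_at intro: smooth_onD)
  then show "\<exists>T. ?P T" ..
next
  assume "\<exists>T. ?P T"
  then obtain T where T: "?P T" ..
  then have "continuous_on T y" by (auto intro: continuous_at_imp_continuous_on)
  moreover have "smooth_on (T \<inter> y -` U) (\<phi> \<circ> y)" if "(U, \<phi>) \<in> \<A>" for U \<phi>
    by (rule smooth_onI) (use T that in auto)
  ultimately show "smooth_into \<A> {x} y" using T unfolding smooth_into_def by blast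
qed

lemma smooth_into_isCont:
  assumes "smooth_into \<A> {x} y" shows "isCont y x"
  using assms by (auto simp: smooth_into_def continuous_on_eq_continuous_at)

lemma smooth_into_chart:
  assumes "smooth_into \<A> {x} y" "(U, \<phi>) \<in> \<A>" "y x \<in> U"
  shows "smooth_on {x} (\<phi> \<circ> y)"
proof -
  obtain T where "x \<in> T" "smooth_on (T \<inter> y -` U) (\<phi> \<circ> y)"
    using assms(1,2) unfolding smooth_into_def by blast
  then show ?thesis using assms(3) smooth_onD by blast
qed

lemma smooth_into_eventually:
  assumes "smooth_into \<A> {x} y"
  shows "eventually (\<lambda>z. smooth_into \<A> {z} y) (nhds x)"
proof -
  obtain T where "open T" "x \<in> T" "smooth_into \<A> T y"
    using assms unfolding smooth_into_def by blast
  then show ?thesis using smooth_into_pointwise[of \<A> T y] by (auto simp: eventually_nhds)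
qed

lemma isCont_eventually_in:
  assumes "isCont y x" "open U" "y x \<in> U"
  shows "eventually (\<lambda>z. y z \<in> U) (nhds x)"
  using assms continuous_at_open[of x y] by (auto simp: eventually_nhds)

text \<open>Allows a map defined by cases to be checked piece by piece, as is done for the
  variation.\<close>

lemma smooth_into_cong_ev:
  assumes "smooth_into \<A> {x} y" "eventually (\<lambda>z. y z = w z) (nhds x)" "smooth_atlas \<A>"
  shows "smooth_into \<A> {x} w"
proof -
  obtain T where T: "open T" "x \<in> T"
    "\<And>z. z \<in> T \<Longrightarrow> isCont y z \<and> (\<forall>(U, \<phi>)\<in>\<A>. y z \<in> U \<longrightarrow> smooth_on {z} (\<phi> \<circ> y))"
    using assms(1) unfolding smooth_into_at_iff[OF assms(3)] by blast
  obtain S where S: "open S" "x \<in> S" "\<And>z. z \<in> S \<Longrightarrow> y z = w z"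
    using assms(2) by (auto simp: eventually_nhds)
  have "isCont w z \<and> (\<forall>(U, \<phi>)\<in>\<A>. w z \<in> U \<longrightarrow> smooth_on {z} (\<phi> \<circ> w))" if z: "z \<in> T \<inter> S" for z
  proof -
    have ev: "eventually (\<lambda>z. y z = w z) (nhds z)"
      using S z by (auto simp: eventually_nhds)
    have "smooth_on {z} (\<phi> \<circ> w)" if "(U, \<phi>) \<in> \<A>" "w z \<in> U" for U \<phi>
      by (rule smooth_on_cong_ev[of _ "\<phi> \<circ> y"])
        (use T(3)[of z] S(3)[of z] z that ev in \<open>auto elim: eventually_mono\<close>)
    then show ?thesis using T(3)[of z] z isCont_cong[OF ev] by auto
  qed
  then show ?thesis unfolding smooth_into_at_iff[OF assms(3)]
    using T S by (intro exI[of _ "T \<inter> S"]) auto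
qed

lemma smooth_into_compose:
  fixes f :: "'a::real_normed_vector \<Rightarrow> 'b::euclidean_space"
  assumes y: "smooth_into \<A> {f x} y" and f: "smooth_on {x} f" and "smooth_atlas \<A>"
  shows "smooth_into \<A> {x} (\<lambda>x. y (f x))"
proof -
  obtain T where T: "open T" "f x \<in> T"
    "\<And>z. z \<in> T \<Longrightarrow> isCont y z \<and> (\<forall>(U, \<phi>)\<in>\<A>. y z \<in> U \<longrightarrow> smooth_on {z} (\<phi> \<circ> y))"
    using y unfolding smooth_into_at_iff[OF assms(3)] by blast
  have "eventually (\<lambda>z. f z \<in> T \<and> smooth_on {z} f) (nhds x)"
    using isCont_eventually_in[OF smooth_on_isCont[OF f] T(1)] T(2) smooth_on_eventually[OF f]
    by (auto intro: eventually_conj)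
  then obtain S where S: "open S" "x \<in> S" "\<And>z. z \<in> S \<Longrightarrow> f z \<in> T \<and> smooth_on {z} f"
    by (auto simp: eventually_nhds)
  have "isCont (\<lambda>x. y (f x)) z" if "z \<in> S" for z
    using isCont_o2[of z f y] T(3)[of "f z"] S(3)[of z] smooth_on_isCont[of "{z}" f z] that by auto
  moreover have "smooth_on {z} (\<phi> \<circ> (\<lambda>x. y (f x)))" if "z \<in> S" "(U, \<phi>) \<in> \<A>" "y (f z) \<in> U" for z U \<phi>
    using smooth_on_compose_at[of f z "\<phi> \<circ> y"] T(3)[of "f z"] S(3)[of z] that by (auto simp: o_def)
  ultimately show ?thesis unfolding smooth_into_at_iff[OF assms(3)]
    using S by blast
qed

text \<open>Seen in another chart, the inverse chart is a transition map, smooth by the definition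
  of an atlas. It carries coordinate constructions back to the manifold.\<close>

lemma smooth_into_inv_chart:
  assumes A: "smooth_atlas \<A>" and c: "(U, \<phi>) \<in> \<A>" and "x \<in> \<phi> ` U"
  shows "smooth_into \<A> {x} (inv_into U \<phi>)"
  unfolding smooth_into_at_iff[OF A]
proof (intro exI[of _ "\<phi> ` U"] conjI ballI)
  note cD = smooth_atlasD[OF A c]
  show "open (\<phi> ` U)" "x \<in> \<phi> ` U" using cD assms(3) by auto
  fix z assume z: "z \<in> \<phi> ` U"
  show "isCont (inv_into U \<phi>) z"
    using cD(2,3) z by (auto simp: homeomorphism_def continuous_on_eq_continuous_at)
  fix d assume d: "d \<in> \<A>"
  obtain V \<psi> where [simp]: "d = (V, \<psi>)" by (cases d)
  show "case d of (V, \<psi>) \<Rightarrow> inv_into U \<phi> z \<in> V \<longrightarrow> smooth_on {z} (\<psi> \<circ> inv_into U \<phi>)"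
  proof (simp, intro impI)
    assume "inv_into U \<phi> z \<in> V"
    then have "z \<in> \<phi> ` (U \<inter> V)"
      using z f_inv_into_f[OF z] inv_into_into[OF z] by (metis IntI imageI)
    moreover have "smooth_on (\<phi> ` (U \<inter> V)) (\<psi> \<circ> inv_into U \<phi>)"
      using A c d unfolding smooth_atlas_def by fastforce
    ultimately show "smooth_on {z} (\<psi> \<circ> inv_into U \<phi>)" using smooth_onD by blast
  qed
qed

section \<open>The pull-back in an arbitrary chart\<close>

text \<open>The pull-back as pure algebra in the component array and the matrix of first
  derivatives; the two can then be varied by formulas, without a map behind them.\<close>

definition tensor_pull :: "real^('p \<Rightarrow> 'n::finite) \<Rightarrow> ('d \<Rightarrow> 'n \<Rightarrow> real) \<Rightarrow> real^('p::finite \<Rightarrow> 'd::finite)" where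
  "tensor_pull \<theta> q = (\<chi> a. \<Sum>B\<in>UNIV. \<theta> $ B * (\<Prod>r\<in>UNIV. q (a r) (B r)))"

lemma smooth_on_tensor_pull [smooth_intros]:
  fixes \<theta> :: "'a::real_normed_vector \<Rightarrow> real^('p::finite \<Rightarrow> 'n::finite)"
    and q :: "'d::finite \<Rightarrow> 'n \<Rightarrow> 'a \<Rightarrow> real"
  assumes "smooth_on S \<theta>" "\<And>\<alpha> B. smooth_on S (q \<alpha> B)"
  shows "smooth_on S (\<lambda>x. tensor_pull (\<theta> x) (\<lambda>\<alpha> B. q \<alpha> B x))"
  unfolding tensor_pull_def using assms by (auto intro!: smooth_intros)

text \<open>The chain rule expresses the derivatives in the selected chart by those in
  \<open>(U, \<phi>)\<close> and the Jacobian of the transition map, one Jacobian factor per slot;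
  the transformation law of \<Theta> absorbs exactly these factors.\<close>

lemma pullback_chart:
  fixes \<A> :: "('m::{t2_space,second_countable_topology}, 'n::finite) chart set"
    and \<Theta> :: "('m, 'n, 'p::finite) tensor" and y :: "real^'d::finite \<Rightarrow> 'm"
  assumes A: "smooth_atlas \<A>" and \<Theta>: "covariant_tensor_field \<A> \<Theta>" and c: "(U, \<phi>) \<in> \<A>"
    and "y \<xi> \<in> U" "isCont y \<xi>" "(\<phi> \<circ> y) differentiable (at \<xi>)"
  shows "pullback \<A> \<Theta> y \<xi> = tensor_pull (\<Theta> (U, \<phi>) (\<phi> (y \<xi>))) (\<lambda>\<alpha> B. dcoord (U, \<phi>) y \<alpha> B \<xi>)"
proof -
  obtain V \<psi> where V: "chart_at \<A> (y \<xi>) = (V, \<psi>)" by (cases "chart_at \<A> (y \<xi>)")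
  then have d: "(V, \<psi>) \<in> \<A>" "y \<xi> \<in> V" using chart_at[OF A, of "y \<xi>"] by auto
  let ?\<tau> = "\<psi> \<circ> inv_into U \<phi>"
  have inj: "inv_into U \<phi> (\<phi> m) = m" if "m \<in> U" for m
    using smooth_atlasD(4)[OF A c] that by simp
  have "smooth_on {\<phi> (y \<xi>)} ?\<tau>"
    using smooth_into_chart[OF smooth_into_inv_chart[OF A c] d(1), of "\<phi> (y \<xi>)"] inj assms(4) d by simp
  then have \<tau>: "?\<tau> differentiable (at ((\<phi> \<circ> y) \<xi>))"
    using smooth_on_differentiable by auto
  \<comment> \<open>Continuity keeps nearby images in \<open>U\<close>, so the factorisation through
    the transition map holds on a neighbourhood and may be differentiated.\<close>
  have ev: "eventually (\<lambda>\<eta>. (\<psi> \<circ> y) \<eta> = ?\<tau> ((\<phi> \<circ> y) \<eta>)) (nhds \<xi>)"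
    using isCont_eventually_in[OF assms(5) smooth_atlasD(1)[OF A c] assms(4)]
    by eventually_elim (simp add: inj)
  have chain: "dcoord (V, \<psi>) y \<alpha> C \<xi> = (\<Sum>B\<in>UNIV. dcoord (U, \<phi>) y \<alpha> B \<xi> * pd B ?\<tau> (\<phi> (y \<xi>)) $ C)" for \<alpha> C
  proof -
    have "((\<lambda>\<eta>. ?\<tau> ((\<phi> \<circ> y) \<eta>)) has_derivative
        (\<lambda>v. frechet_derivative ?\<tau> (at ((\<phi> \<circ> y) \<xi>)) (frechet_derivative (\<phi> \<circ> y) (at \<xi>) v))) (at \<xi>)"
      by (rule has_derivative_compose[OF assms(6)[unfolded frechet_derivative_works] \<tau>[unfolded frechet_derivative_works]])
    then have "pd \<alpha> (\<psi> \<circ> y) \<xi> = frechet_derivative ?\<tau> (at ((\<phi> \<circ> y) \<xi>)) (pd \<alpha> (\<phi> \<circ> y) \<xi>)"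
      unfolding pd_cong_ev[OF ev] by (simp add: pd_eqI) (simp add: pd_def)
    then show ?thesis
      using frechet_derivative_eq_sum_pd[OF \<tau>] by (simp add: dcoord_def)
  qed
  have trans: "\<Theta> (U, \<phi>) (\<phi> (y \<xi>)) $ B =
      (\<Sum>C\<in>UNIV. \<Theta> (V, \<psi>) (\<psi> (y \<xi>)) $ C * (\<Prod>r\<in>UNIV. pd (B r) ?\<tau> (\<phi> (y \<xi>)) $ C r))" for B
  proof -
    have "y \<xi> \<in> U \<inter> V" using assms(4) d by auto
    then show ?thesis using \<Theta> c d(1) unfolding covariant_tensor_field_def by blast
  qed
  have "pullback \<A> \<Theta> y \<xi> $ a = tensor_pull (\<Theta> (U, \<phi>) (\<phi> (y \<xi>))) (\<lambda>\<alpha> B. dcoord (U, \<phi>) y \<alpha> B \<xi>) $ a" for a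
  proof -
    have "pullback \<A> \<Theta> y \<xi> $ a = (\<Sum>C\<in>UNIV. \<Theta> (V, \<psi>) (\<psi> (y \<xi>)) $ C * (\<Prod>r\<in>UNIV. dcoord (V, \<psi>) y (a r) (C r) \<xi>))"
      by (simp add: pullback_def V Let_def)
    \<comment> \<open>A product over slots of sums over one index is a sum over multi-indices, that
      is, over functions from slots to indices.\<close>
    also have "\<dots> = (\<Sum>C\<in>UNIV. \<Theta> (V, \<psi>) (\<psi> (y \<xi>)) $ C *
        (\<Sum>B\<in>UNIV. \<Prod>r\<in>UNIV. dcoord (U, \<phi>) y (a r) (B r) \<xi> * pd (B r) ?\<tau> (\<phi> (y \<xi>)) $ C r))"
      unfolding chain by (subst prod_sum_PiE) auto
    also have "\<dots> = (\<Sum>B\<in>UNIV. (\<Sum>C\<in>UNIV. \<Theta> (V, \<psi>) (\<psi> (y \<xi>)) $ C *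
        (\<Prod>r\<in>UNIV. pd (B r) ?\<tau> (\<phi> (y \<xi>)) $ C r)) * (\<Prod>r\<in>UNIV. dcoord (U, \<phi>) y (a r) (B r) \<xi>))"
      unfolding sum_distrib_left sum_distrib_right
      by (subst sum.swap) (simp add: prod.distrib mult_ac)
    finally show ?thesis by (simp add: tensor_pull_def trans)
  qed
  then show ?thesis by (simp add: vec_eq_iff)
qed

lemma smooth_on_dcoord:
  assumes "smooth_into \<A> {\<xi>} y" "(U, \<phi>) \<in> \<A>" "y \<xi> \<in> U"
  shows "smooth_on {\<xi>} (dcoord (U, \<phi>) y \<alpha> B)"
  unfolding dcoord_def[abs_def]
  using smooth_into_chart[OF assms] by (auto intro!: smooth_intros)

text \<open>A chart fixed around \<open>y \<xi>\<close> serves all nearby points, whatever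
  \<open>chart_at\<close> selects there.\<close>

lemma smooth_on_pullback:
  fixes \<A> :: "('m::{t2_space,second_countable_topology}, 'n::finite) chart set"
    and \<Theta> :: "('m, 'n, 'p::finite) tensor" and y :: "real^'d::finite \<Rightarrow> 'm"
  assumes A: "smooth_atlas \<A>" and \<Theta>: "covariant_tensor_field \<A> \<Theta>" and y: "smooth_into \<A> {\<xi>} y"
  shows "smooth_on {\<xi>} (pullback \<A> \<Theta> y)"
proof -
  obtain U \<phi> where c: "(U, \<phi>) \<in> \<A>" "y \<xi> \<in> U"
    using chart_at[OF A, of "y \<xi>"] by (metis prod.collapse)
  have "smooth_on (\<phi> ` U) (\<Theta> (U, \<phi>))"
    using \<Theta> c(1) unfolding covariant_tensor_field_def by blast
  then have "smooth_on {\<phi> (y \<xi>)} (\<Theta> (U, \<phi>))" using c(2) smooth_onD by blast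
  then have "smooth_on {\<xi>} (\<lambda>\<eta>. \<Theta> (U, \<phi>) ((\<phi> \<circ> y) \<eta>))"
    using smooth_on_compose_at[of "\<phi> \<circ> y" \<xi> "\<Theta> (U, \<phi>)"] smooth_into_chart[OF y c] by simp
  then have "smooth_on {\<xi>} (\<lambda>\<eta>. tensor_pull (\<Theta> (U, \<phi>) ((\<phi> \<circ> y) \<eta>)) (\<lambda>\<alpha> B. dcoord (U, \<phi>) y \<alpha> B \<eta>))"
    by (intro smooth_intros smooth_on_dcoord[OF y c])
  moreover have "eventually (\<lambda>\<eta>. tensor_pull (\<Theta> (U, \<phi>) ((\<phi> \<circ> y) \<eta>)) (\<lambda>\<alpha> B. dcoord (U, \<phi>) y \<alpha> B \<eta>)
      = pullback \<A> \<Theta> y \<eta>) (nhds \<xi>)"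
    using smooth_into_eventually[OF y]
      isCont_eventually_in[OF smooth_into_isCont[OF y] smooth_atlasD(1)[OF A c(1)] c(2)]
    by eventually_elim
      (simp add: pullback_chart[OF A \<Theta> c(1)] smooth_into_isCont
        smooth_on_differentiable[OF smooth_into_chart[OF _ c(1)]])
  ultimately show ?thesis by (rule smooth_on_cong_ev)
qed

section \<open>Varying the pulled-back tensor\<close>

lemma has_real_derivative_compose_vec:
  fixes f :: "real^'k::finite \<Rightarrow> real" and g :: "'k \<Rightarrow> real \<Rightarrow> real"
  assumes f: "f differentiable (at (\<chi> i. g i x))"
    and g: "\<And>i. (g i has_real_derivative g' i) (at x)"
  shows "((\<lambda>\<epsilon>. f (\<chi> i. g i \<epsilon>)) has_real_derivative (\<Sum>i\<in>UNIV. g' i * pd i f (\<chi> i. g i x))) (at x)"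
proof -
  have "((\<lambda>\<epsilon>. \<Sum>i\<in>UNIV. g i \<epsilon> *\<^sub>R axis i 1 :: real^'k) has_derivative (\<lambda>h. \<Sum>i\<in>UNIV. (g' i * h) *\<^sub>R axis i 1)) (at x)"
    using g unfolding has_field_derivative_def by (intro has_derivative_sum has_derivative_scaleR_left)
  moreover have ax: "(\<Sum>i\<in>UNIV. c i *\<^sub>R axis i 1 :: real^'k) = (\<chi> i. c i)" for c
    by (simp add: vec_eq_iff axis_def sum.delta' if_distrib cong: if_cong)
  ultimately have "((\<lambda>\<epsilon>. \<chi> i. g i \<epsilon>) has_derivative (\<lambda>h. \<chi> i. g' i * h)) (at x)"
    by simp
  from has_derivative_compose[OF this f[unfolded frechet_derivative_works]]
  have "((\<lambda>\<epsilon>. f (\<chi> i. g i \<epsilon>)) has_derivative (\<lambda>h. \<Sum>i\<in>UNIV. (g' i * h) * pd i f (\<chi> i. g i x))) (at x)"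
    by (simp add: frechet_derivative_eq_sum_pd[OF f])
  moreover have "(\<lambda>h. \<Sum>i\<in>UNIV. (g' i * h) * pd i f (\<chi> i. g i x)) = (*) (\<Sum>i\<in>UNIV. g' i * pd i f (\<chi> i. g i x))"
    by (simp add: fun_eq_iff sum_distrib_right sum_distrib_left mult_ac)
  ultimately show ?thesis by (simp add: has_field_derivative_def)
qed

text \<open>The derivative of \<open>tensor_pull (\<theta> x) q\<close> when \<open>x\<close> moves by \<open>v\<close> along the \<open>A\<close>-th axis and the
  column \<open>q _ A\<close> moves by \<open>w\<close>.\<close>

definition dtensor_pull :: "(real^'n::finite \<Rightarrow> real^('p::finite \<Rightarrow> 'n)) \<Rightarrow> real^'n \<Rightarrow> ('d \<Rightarrow> 'n \<Rightarrow> real)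
    \<Rightarrow> 'n \<Rightarrow> real \<Rightarrow> ('d \<Rightarrow> real) \<Rightarrow> ('p \<Rightarrow> 'd) \<Rightarrow> real" where
  "dtensor_pull \<theta> x q A v w a =
    (\<Sum>B\<in>UNIV. v * pd A (\<lambda>x. \<theta> x $ B) x * (\<Prod>r\<in>UNIV. q (a r) (B r)) +
       (\<Sum>s\<in>UNIV. (w (a s) * (if B s = A then 1 else 0)) * (\<Prod>r\<in>UNIV - {s}. q (a r) (B r))) * \<theta> x $ B)"

text \<open>The product rule differentiates one slot \<open>s\<close> at a time, and only slots
  carrying \<open>A\<close> move. This is the origin of the sum over slots, with one factor removed,
  in \<open>Stress_tilde\<close>.\<close>

lemma has_real_derivative_tensor_pull:
  fixes \<theta> :: "real^'n::finite \<Rightarrow> real^('p::finite \<Rightarrow> 'n)" and q :: "'d::finite \<Rightarrow> 'n \<Rightarrow> real"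
  assumes "\<theta> differentiable (at x)"
  shows "((\<lambda>\<epsilon>. tensor_pull (\<theta> (x + (\<epsilon> * v) *\<^sub>R axis A 1))
      (\<lambda>\<alpha> B. q \<alpha> B + \<epsilon> * (w \<alpha> * (if B = A then 1 else 0))) $ a)
    has_real_derivative dtensor_pull \<theta> x q A v w a) (at 0)"
proof -
  have \<theta>: "(\<lambda>x. \<theta> x $ B) differentiable (at x)" for B
    using assms bounded_linear.has_derivative[OF bounded_linear_vec_nth] unfolding differentiable_def by blast
  have "((\<lambda>\<epsilon>. q \<alpha> B + \<epsilon> * c) has_real_derivative c) (at 0)" for \<alpha> B c
    by (auto intro!: derivative_eq_intros)
  then have "((\<lambda>\<epsilon>. \<Prod>r\<in>UNIV. q (a r) (B r) + \<epsilon> * (w (a r) * (if B r = A then 1 else 0)))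
      has_real_derivative (\<Sum>s\<in>UNIV. (w (a s) * (if B s = A then 1 else 0)) *
        (\<Prod>r\<in>UNIV - {s}. q (a r) (B r) + 0 * (w (a r) * (if B r = A then 1 else 0))))) (at 0)" for B
    by (rule has_field_derivative_prod)
  note prod = this
  show ?thesis
    unfolding tensor_pull_def dtensor_pull_def vec_lambda_beta
    by (rule DERIV_cong[OF DERIV_sum[OF DERIV_mult[OF has_real_derivative_line[OF \<theta>] prod]]])
      (simp add: algebra_simps)
qed

text \<open>The fibres of \<open>\<lambda>a. a s\<close> partition the multi-indices.\<close>

lemma sum_fibre_mult:
  fixes f :: "('p::finite \<Rightarrow> 'd::finite) \<Rightarrow> real"
  shows "(\<Sum>\<alpha>\<in>UNIV. w \<alpha> * (\<Sum>a | a s = \<alpha>. f a)) = (\<Sum>a\<in>UNIV. w (a s) * f a)"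
proof -
  have "(\<Sum>\<alpha>\<in>UNIV. w \<alpha> * (\<Sum>a | a s = \<alpha>. f a)) = (\<Sum>\<alpha>\<in>UNIV. \<Sum>a | a s = \<alpha>. w (a s) * f a)"
    by (intro sum.cong) (auto simp: sum_distrib_left)
  also have "\<dots> = (\<Sum>a\<in>UNIV. w (a s) * f a)"
    using sum.group[of UNIV UNIV "\<lambda>a. a s" "\<lambda>a. w (a s) * f a"] by simp
  finally show ?thesis .
qed

text \<open>Sorts the work of the stress by its cause: the moved position meets the gradient of
  \<Theta>, the moved slopes meet \<open>Stress_tilde\<close>. These become the two stress terms of
  the equation.\<close>

lemma sum_stress_dtensor_pull:
  fixes \<Theta> :: "('m, 'n::finite, 'p::finite) tensor" and y :: "real^'d::finite \<Rightarrow> 'm"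
  shows "(\<Sum>a\<in>UNIV. \<Sigma> \<xi> $ a *
      dtensor_pull (\<Theta> (U, \<phi>)) (\<phi> (y \<xi>)) (\<lambda>\<alpha> B. dcoord (U, \<phi>) y \<alpha> B \<xi>) A v w a) =
    v * (\<Sum>a\<in>UNIV. \<Sum>B\<in>UNIV. \<Sigma> \<xi> $ a * pd A (\<lambda>x. \<Theta> (U, \<phi>) x $ B) (\<phi> (y \<xi>)) *
           (\<Prod>r\<in>UNIV. dcoord (U, \<phi>) y (a r) (B r) \<xi>)) +
    (\<Sum>\<alpha>\<in>UNIV. w \<alpha> * Stress_tilde (U, \<phi>) \<Theta> y \<Sigma> \<alpha> A \<xi>)"
proof -
  let ?X = "\<lambda>s a B. \<Sigma> \<xi> $ a * \<Theta> (U, \<phi>) (\<phi> (y \<xi>)) $ B * (\<Prod>r\<in>UNIV - {s}. dcoord (U, \<phi>) y (a r) (B r) \<xi>)"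
  have "(\<Sum>\<alpha>\<in>UNIV. w \<alpha> * Stress_tilde (U, \<phi>) \<Theta> y \<Sigma> \<alpha> A \<xi>)
      = (\<Sum>s\<in>UNIV. \<Sum>\<alpha>\<in>UNIV. w \<alpha> * (\<Sum>a | a s = \<alpha>. \<Sum>B | B s = A. ?X s a B))"
    unfolding Stress_tilde_def by (simp add: sum_distrib_left) (rule sum.swap)
  also have "\<dots> = (\<Sum>s\<in>UNIV. \<Sum>a\<in>UNIV. w (a s) * (\<Sum>B | B s = A. ?X s a B))"
    by (simp add: sum_fibre_mult)
  also have "\<dots> = (\<Sum>s\<in>UNIV. \<Sum>a\<in>UNIV. \<Sum>B\<in>UNIV. w (a s) * (if B s = A then 1 else 0) * ?X s a B)"
  proof (intro sum.cong refl)
    fix s :: 'p and a :: "'p \<Rightarrow> 'd"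
    have "(\<Sum>B | B s = A. ?X s a B) = (\<Sum>B\<in>UNIV. if B s = A then ?X s a B else 0)"
      by (simp add: sum.If_cases)
    then show "w (a s) * (\<Sum>B | B s = A. ?X s a B)
        = (\<Sum>B\<in>UNIV. w (a s) * (if B s = A then 1 else 0) * ?X s a B)"
      by (simp add: sum_distrib_left if_distrib cong: if_cong)
        (intro sum.cong, auto)
  qed
  also have "\<dots> = (\<Sum>a\<in>UNIV. \<Sum>B\<in>UNIV. \<Sum>s\<in>UNIV. w (a s) * (if B s = A then 1 else 0) * ?X s a B)"
    by (subst sum.swap) (intro sum.cong refl sum.swap)
  finally show ?thesis
    unfolding dtensor_pull_def
    by (simp add: sum_distrib_left sum_distrib_right sum.distrib distrib_left mult_ac)
qed

section \<open>The stress and the residual of the equilibrium equations\<close>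

locale stationary_embedding =
  fixes \<A> :: "('m::{t2_space,second_countable_topology}, 'n::finite) chart set"
    and \<Theta> :: "('m, 'n, 'p::finite) tensor"
    and \<B> :: "(real^'d::finite) set"
    and x0 y :: "real^'d \<Rightarrow> 'm"
    and F0 :: "real^'d \<Rightarrow> real^('p \<Rightarrow> 'd) \<Rightarrow> real"
    and \<U> :: "'m \<Rightarrow> real"
    and vol :: "real^('p \<Rightarrow> 'd) \<Rightarrow> real"
    and D :: "((real^'d) \<times> (real^('p \<Rightarrow> 'd))) set"
    and P :: "(real^('p \<Rightarrow> 'd)) set"
  assumes manifold: "smooth_atlas \<A>"
    and tensor: "covariant_tensor_field \<A> \<Theta>"
    and body: "compact \<B>" "closure (interior \<B>) = \<B>"
    and initial: "smooth_into \<A> \<B> x0"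
    and current: "smooth_into \<A> \<B> y"
    and potential: "smooth_function \<A> \<U>"
    and elastic: "open D" "smooth_on D (\<lambda>(\<xi>, t). F0 \<xi> t)"
      "\<And>\<xi>. \<xi> \<in> \<B> \<Longrightarrow> (\<xi>, deformation \<A> \<Theta> x0 y \<xi>) \<in> D"
    and volume: "open P" "smooth_on P vol" "\<And>t. t \<in> P \<Longrightarrow> vol t > 0"
      "\<And>\<xi>. \<xi> \<in> \<B> \<Longrightarrow> pullback \<A> \<Theta> y \<xi> \<in> P"
    and stationary: "\<And>Y. smooth_variation \<A> \<B> y Y \<Longrightarrow> variation_field_zero_on \<A> (frontier \<B>) Y \<Longrightarrow>
      ((\<lambda>\<epsilon>. energy \<A> \<Theta> \<B> x0 F0 \<U> vol (Y \<epsilon>)) has_real_derivative 0) (at 0)"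
begin

abbreviation "\<Sigma> \<equiv> Stress \<A> \<Theta> x0 F0 \<U> vol y"
abbreviation "\<Delta> \<equiv> deformation \<A> \<Theta> x0 y"
abbreviation "y\<Theta> \<equiv> pullback \<A> \<Theta> y"

lemma y_into: "\<xi> \<in> \<B> \<Longrightarrow> smooth_into \<A> {\<xi>} y"
  using current smooth_into_pointwise by blast

lemma smooth_y\<Theta>: "\<xi> \<in> \<B> \<Longrightarrow> smooth_on {\<xi>} y\<Theta>"
  by (rule smooth_on_pullback[OF manifold tensor y_into])

lemma smooth_x0\<Theta>: "\<xi> \<in> \<B> \<Longrightarrow> smooth_on {\<xi>} (pullback \<A> \<Theta> x0)"
  by (rule smooth_on_pullback[OF manifold tensor]) (use initial smooth_into_pointwise in blast)

lemma smooth_\<Delta>: "\<xi> \<in> \<B> \<Longrightarrow> smooth_on {\<xi>} \<Delta>"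
  unfolding deformation_def[abs_def] by (intro smooth_on_diff smooth_y\<Theta> smooth_x0\<Theta>)

text \<open>Smoothness at a boundary point concerns a full neighbourhood, which leaves the body;
  openness of \<open>D\<close> and \<open>P\<close> keeps the arguments admissible there.\<close>

lemma eventually_in_domains:
  assumes "\<xi> \<in> \<B>"
  shows "eventually (\<lambda>\<eta>. (\<eta>, \<Delta> \<eta>) \<in> D \<and> y\<Theta> \<eta> \<in> P) (nhds \<xi>)"
proof (rule eventually_conj)
  have "smooth_on {\<xi>} (\<lambda>\<eta>. (\<eta>, \<Delta> \<eta>))" by (intro smooth_intros smooth_\<Delta> assms)
  then show "eventually (\<lambda>\<eta>. (\<eta>, \<Delta> \<eta>) \<in> D) (nhds \<xi>)"
    using isCont_eventually_in[OF smooth_on_isCont elastic(1)] elastic(3) assms by auto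
  show "eventually (\<lambda>\<eta>. y\<Theta> \<eta> \<in> P) (nhds \<xi>)"
    using isCont_eventually_in[OF smooth_on_isCont[OF smooth_y\<Theta>] volume(1)] volume(4) assms by auto
qed

lemma smooth_F0_compose:
  assumes "(f x, g x) \<in> D" "smooth_on {x} f" "smooth_on {x} g"
  shows "smooth_on {x} (\<lambda>x. F0 (f x) (g x))"
  using smooth_on_compose_at[OF smooth_onD[OF elastic(2) assms(1)] smooth_on_Pair[OF assms(2,3)]] by simp

text \<open>The stress differentiates \<open>F0 \<xi>\<close> at frozen \<xi>. Read as a directional
  derivative of the joint function, it is seen to depend smoothly on \<xi> too.\<close>

lemma pd_F0:
  assumes "(\<xi>, \<tau>) \<in> D"
  shows "F0 \<xi> differentiable (at \<tau>)"
    "pd a (F0 \<xi>) \<tau> = frechet_derivative (\<lambda>(\<xi>, t). F0 \<xi> t) (at (\<xi>, \<tau>)) (0, axis a 1)"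
proof -
  have "((\<lambda>\<tau>. (\<xi>, \<tau>)) has_derivative (\<lambda>h. (0, h))) (at \<tau>)"
    by (auto intro!: derivative_eq_intros)
  from has_derivative_compose[OF this smooth_on_has_derivative[OF elastic(2) assms]]
  have "(F0 \<xi> has_derivative (\<lambda>h. frechet_derivative (\<lambda>(\<xi>, t). F0 \<xi> t) (at (\<xi>, \<tau>)) (0, h))) (at \<tau>)"
    by simp
  then show "F0 \<xi> differentiable (at \<tau>)"
    "pd a (F0 \<xi>) \<tau> = frechet_derivative (\<lambda>(\<xi>, t). F0 \<xi> t) (at (\<xi>, \<tau>)) (0, axis a 1)"
    by (auto simp: differentiable_def pd_eqI)
qed

lemma pd_ln_vol:
  assumes "t \<in> P"
  shows "pd a (\<lambda>t. ln (vol t)) t = inverse (vol t) * pd a vol t"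
proof -
  have "((\<lambda>t. ln (vol t)) has_derivative (\<lambda>h. frechet_derivative vol (at t) h * inverse (vol t))) (at t)"
    by (rule has_derivative_ln[OF volume(3)[OF assms] smooth_on_has_derivative[OF volume(2) assms]])
  then show ?thesis by (simp add: pd_eqI) (simp add: pd_def)
qed

lemma smooth_\<U>_compose:
  fixes z :: "'a::real_normed_vector \<Rightarrow> 'm"
  assumes z: "smooth_into \<A> {x} z"
  shows "smooth_on {x} (\<lambda>x. \<U> (z x))"
proof -
  obtain U \<phi> where c: "(U, \<phi>) \<in> \<A>" "z x \<in> U"
    using chart_at[OF manifold, of "z x"] by (metis prod.collapse)
  have "smooth_on (\<phi> ` U) (\<U> \<circ> inv_into U \<phi>)"
    using potential c(1) unfolding smooth_function_def by blast
  then have "smooth_on {(\<phi> \<circ> z) x} (\<U> \<circ> inv_into U \<phi>)" using c(2) smooth_onD by (metis comp_apply imageI)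
  from smooth_on_compose_at[OF this smooth_into_chart[OF z c]]
  have "smooth_on {x} (\<lambda>x. (\<U> \<circ> inv_into U \<phi>) ((\<phi> \<circ> z) x))" .
  moreover have "eventually (\<lambda>x. (\<U> \<circ> inv_into U \<phi>) ((\<phi> \<circ> z) x) = \<U> (z x)) (nhds x)"
    using isCont_eventually_in[OF smooth_into_isCont[OF z] smooth_atlasD(1)[OF manifold c(1)] c(2)]
    by eventually_elim (simp add: inv_into_f_f[OF smooth_atlasD(4)[OF manifold c(1)]])
  ultimately show ?thesis by (rule smooth_on_cong_ev)
qed

lemma smooth_vol: "\<xi> \<in> \<B> \<Longrightarrow> smooth_on {\<xi>} (\<lambda>\<eta>. vol (y\<Theta> \<eta>))"
  by (rule smooth_on_compose_at[OF smooth_onD[OF volume(2) volume(4)] smooth_y\<Theta>])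

lemma smooth_Stress:
  assumes \<xi>: "\<xi> \<in> \<B>"
  shows "smooth_on {\<xi>} \<Sigma>"
proof (rule smooth_on_cong_ev)
  let ?F = "\<lambda>(\<xi>, t). F0 \<xi> t"
  have 1: "smooth_on {\<xi>} (\<lambda>\<eta>. frechet_derivative ?F (at (\<eta>, \<Delta> \<eta>)) (0, axis a 1))" for a
    by (rule smooth_on_compose_at[where f = "\<lambda>\<eta>. (\<eta>, \<Delta> \<eta>)",
          OF smooth_on_derivative[OF smooth_onD[OF elastic(2) elastic(3)[OF \<xi>]]]])
      (intro smooth_intros smooth_\<Delta> \<xi>)
  have 2: "smooth_on {\<xi>} (\<lambda>\<eta>. pd a vol (y\<Theta> \<eta>))" for a
    by (rule smooth_on_compose_at[OF smooth_on_pd[OF smooth_onD[OF volume(2) volume(4)]] smooth_y\<Theta>]) fact+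
  have 3: "smooth_on {\<xi>} (\<lambda>\<eta>. inverse (vol (y\<Theta> \<eta>)))"
    using volume(3)[OF volume(4)[OF \<xi>]] by (intro smooth_on_inverse smooth_vol \<xi>) auto
  have 4: "smooth_on {\<xi>} (\<lambda>\<eta>. F0 \<eta> (\<Delta> \<eta>))"
    by (rule smooth_F0_compose) (use elastic(3) \<xi> in \<open>auto intro: smooth_intros smooth_\<Delta>\<close>)
  show "smooth_on {\<xi>} (\<lambda>\<eta>. \<chi> a. frechet_derivative ?F (at (\<eta>, \<Delta> \<eta>)) (0, axis a 1) +
      (F0 \<eta> (\<Delta> \<eta>) + \<U> (y \<eta>)) * (inverse (vol (y\<Theta> \<eta>)) * pd a vol (y\<Theta> \<eta>)))"
    by (intro smooth_on_vec_lambda smooth_on_add smooth_on_mult 1 2 3 4 smooth_\<U>_compose y_into \<xi>)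
  show "eventually (\<lambda>\<eta>. (\<chi> a. frechet_derivative ?F (at (\<eta>, \<Delta> \<eta>)) (0, axis a 1) +
      (F0 \<eta> (\<Delta> \<eta>) + \<U> (y \<eta>)) * (inverse (vol (y\<Theta> \<eta>)) * pd a vol (y\<Theta> \<eta>))) = \<Sigma> \<eta>) (nhds \<xi>)"
    using eventually_in_domains[OF \<xi>]
    by eventually_elim (simp add: Stress_def pd_F0(2) pd_ln_vol)
qed

context
  fixes U \<phi> assumes chart: "(U, \<phi>) \<in> \<A>"
begin

text \<open>The coefficient of the partial derivative of \<eta> along \<alpha> in the first
  variation.\<close>

definition momentum :: "'n \<Rightarrow> 'd \<Rightarrow> real^'d \<Rightarrow> real" where
  "momentum A \<alpha> \<eta> = vol (y\<Theta> \<eta>) * Stress_tilde (U, \<phi>) \<Theta> y \<Sigma> \<alpha> A \<eta>"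

text \<open>Multiplied by \<open>vol\<close>, the coefficient of \<eta> itself in the first
  variation: the explicit dependence of \<Theta> and \<open>\<U>\<close> on position.\<close>

definition force :: "'n \<Rightarrow> real^'d \<Rightarrow> real" where
  "force A \<eta> = (\<Sum>a\<in>UNIV. \<Sum>B\<in>UNIV. \<Sigma> \<eta> $ a * pd A (\<lambda>x. \<Theta> (U, \<phi>) x $ B) (\<phi> (y \<eta>)) *
           (\<Prod>r\<in>UNIV. dcoord (U, \<phi>) y (a r) (B r) \<eta>))
      + pd A (\<U> \<circ> inv_into U \<phi>) (\<phi> (y \<eta>))"

text \<open>This is \<open>vol\<close> times the left-hand side of the equilibrium equation.\<close>

definition residual :: "'n \<Rightarrow> real^'d \<Rightarrow> real" where
  "residual A \<eta> = (\<Sum>\<alpha>\<in>UNIV. pd \<alpha> (momentum A \<alpha>) \<eta>) - vol (y\<Theta> \<eta>) * force A \<eta>"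

lemma smooth_\<Theta>: "m \<in> U \<Longrightarrow> smooth_on {\<phi> m} (\<Theta> (U, \<phi>))"
proof -
  have "smooth_on (\<phi> ` U) (\<Theta> (U, \<phi>))"
    using tensor chart unfolding covariant_tensor_field_def by blast
  then show "m \<in> U \<Longrightarrow> smooth_on {\<phi> m} (\<Theta> (U, \<phi>))" using smooth_onD by blast
qed

lemma smooth_\<U>_chart: "m \<in> U \<Longrightarrow> smooth_on {\<phi> m} (\<U> \<circ> inv_into U \<phi>)"
proof -
  have "smooth_on (\<phi> ` U) (\<U> \<circ> inv_into U \<phi>)"
    using potential chart unfolding smooth_function_def by blast
  then show "m \<in> U \<Longrightarrow> smooth_on {\<phi> m} (\<U> \<circ> inv_into U \<phi>)" using smooth_onD by blast
qed

lemma smooth_u: "\<xi> \<in> \<B> \<Longrightarrow> y \<xi> \<in> U \<Longrightarrow> smooth_on {\<xi>} (\<lambda>\<eta>. \<phi> (y \<eta>))"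
  using smooth_into_chart[OF y_into chart] by (simp add: o_def)

lemmas smooth_dcoord = smooth_on_dcoord[OF y_into chart]

lemma smooth_momentum:
  assumes "\<xi> \<in> \<B>" "y \<xi> \<in> U" shows "smooth_on {\<xi>} (momentum A \<alpha>)"
proof -
  have "smooth_on {\<xi>} (\<lambda>\<eta>. \<Theta> (U, \<phi>) (\<phi> (y \<eta>)))"
    by (rule smooth_on_compose_at[OF smooth_\<Theta> smooth_u]) fact+
  then show ?thesis
    unfolding momentum_def[abs_def] Stress_tilde_def snd_conv
    by (intro smooth_on_mult smooth_on_sum smooth_on_prod smooth_on_vec_nth smooth_dcoord smooth_Stress smooth_vol assms)
qed

lemma smooth_force:
  assumes "\<xi> \<in> \<B>" "y \<xi> \<in> U" shows "smooth_on {\<xi>} (force A)"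
proof -
  have 1: "smooth_on {\<xi>} (\<lambda>\<eta>. pd A (\<lambda>x. \<Theta> (U, \<phi>) x $ B) (\<phi> (y \<eta>)))" for B
    by (rule smooth_on_compose_at[OF smooth_on_pd[OF smooth_on_vec_nth[OF smooth_\<Theta>]] smooth_u]) fact+
  have 2: "smooth_on {\<xi>} (\<lambda>\<eta>. pd A (\<U> \<circ> inv_into U \<phi>) (\<phi> (y \<eta>)))"
    by (rule smooth_on_compose_at[OF smooth_on_pd[OF smooth_\<U>_chart] smooth_u]) fact+
  show ?thesis
    unfolding force_def[abs_def]
    by (intro smooth_on_add smooth_on_mult smooth_on_sum smooth_on_prod smooth_on_vec_nth smooth_dcoord
        smooth_Stress 1 2 assms)
qed

lemma smooth_residual:
  assumes "\<xi> \<in> \<B>" "y \<xi> \<in> U" shows "smooth_on {\<xi>} (residual A)"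
  unfolding residual_def[abs_def]
  by (intro smooth_on_diff smooth_on_mult smooth_on_sum smooth_on_pd smooth_momentum smooth_force smooth_vol assms)

end
end

section \<open>The first variation\<close>

lemma smooth_on_compose_snd:
  fixes f :: "'b::euclidean_space \<Rightarrow> 'c::real_normed_vector"
  assumes "smooth_on {x} f"
  shows "smooth_on {(t::'a::real_normed_vector, x)} (\<lambda>z. f (snd z))"
  by (rule smooth_on_compose_at) (use assms in \<open>simp_all add: smooth_on_snd[OF smooth_on_ident]\<close>)

context stationary_embedding
begin

definition energy_density :: "(real^'d \<Rightarrow> 'm) \<Rightarrow> real^'d \<Rightarrow> real" where
  "energy_density z \<xi> = (F0 \<xi> (deformation \<A> \<Theta> x0 z \<xi>) + \<U> (z \<xi>)) * vol (pullback \<A> \<Theta> z \<xi>)"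

lemma energy_eq_integral: "energy \<A> \<Theta> \<B> x0 F0 \<U> vol z = integral \<B> (energy_density z)"
  unfolding energy_def by (rule integral_cong) (simp add: energy_density_def)

text \<open>Lets the energy of a varied map be split into that of \<open>y\<close> and the integral
  of the change.\<close>

lemma energy_density_integrable: "energy_density y integrable_on \<B>"
proof (rule continuous_on_compact_integrable_on[OF body(1)], rule smooth_on_continuous_on, rule smooth_onI)
  fix \<xi> assume \<xi>: "\<xi> \<in> \<B>"
  have "smooth_on {\<xi>} (\<lambda>\<eta>. F0 \<eta> (\<Delta> \<eta>))"
    by (rule smooth_F0_compose) (use elastic(3) \<xi> in \<open>auto intro: smooth_intros smooth_\<Delta>\<close>)
  then show "smooth_on {\<xi>} (energy_density y)"
    unfolding energy_density_def[abs_def]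
    by (intro smooth_on_mult smooth_on_add smooth_\<U>_compose smooth_vol y_into \<xi>)
qed

text \<open>The density depends only on the germ of the map, so it does not change off the support
  of the variation.\<close>

lemma energy_density_cong_ev:
  assumes "eventually (\<lambda>\<eta>. z \<eta> = z' \<eta>) (nhds \<xi>)"
  shows "energy_density z \<xi> = energy_density z' \<xi>"
proof -
  have eq: "z \<xi> = z' \<xi>" using eventually_nhds_x_imp_x[OF assms] .
  have "dcoord c z \<alpha> B \<xi> = dcoord c z' \<alpha> B \<xi>" for c :: "('m, 'n) chart" and \<alpha> B
    unfolding dcoord_def by (subst pd_cong_ev[of "snd c \<circ> z" "snd c \<circ> z'"])
      (use assms in \<open>auto elim: eventually_mono\<close>)
  then have "pullback \<A> \<Theta> z \<xi> = pullback \<A> \<Theta> z' \<xi>"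
    by (simp add: pullback_def eq Let_def)
  then show ?thesis by (simp add: energy_density_def deformation_def eq)
qed

context
  fixes U \<phi> assumes chart: "(U, \<phi>) \<in> \<A>"
begin

text \<open>An explicit formula in \<epsilon> for the pull-back after the coordinate move; its joint
  smoothness can be read off before any varied map is constructed.\<close>

definition moved_tensor :: "'n \<Rightarrow> (real^'d \<Rightarrow> real) \<Rightarrow> real \<Rightarrow> real^'d \<Rightarrow> real^('p \<Rightarrow> 'd)" where
  "moved_tensor A \<eta> \<epsilon> \<xi> = tensor_pull (\<Theta> (U, \<phi>) (\<phi> (y \<xi>) + (\<epsilon> * \<eta> \<xi>) *\<^sub>R axis A 1))
      (\<lambda>\<alpha> B. dcoord (U, \<phi>) y \<alpha> B \<xi> + \<epsilon> * (pd \<alpha> \<eta> \<xi> * (if B = A then 1 else 0)))"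

definition moved_density :: "'n \<Rightarrow> (real^'d \<Rightarrow> real) \<Rightarrow> real \<Rightarrow> real^'d \<Rightarrow> real" where
  "moved_density A \<eta> \<epsilon> \<xi> = (F0 \<xi> (moved_tensor A \<eta> \<epsilon> \<xi> - pullback \<A> \<Theta> x0 \<xi>) +
      (\<U> \<circ> inv_into U \<phi>) (\<phi> (y \<xi>) + (\<epsilon> * \<eta> \<xi>) *\<^sub>R axis A 1)) * vol (moved_tensor A \<eta> \<epsilon> \<xi>)"

lemma moved_tensor_0:
  assumes "\<xi> \<in> \<B>" "y \<xi> \<in> U" shows "moved_tensor A \<eta> 0 \<xi> = y\<Theta> \<xi>"
  using pullback_chart[OF manifold tensor chart assms(2) smooth_into_isCont[OF y_into]
      smooth_on_differentiable[OF smooth_into_chart[OF y_into chart]]] assms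
  by (simp add: moved_tensor_def)

text \<open>After the product rule, both tensor contributions carry the same first-order change of
  the pull-back. Their common coefficient is \<open>vol\<close> times the stress.\<close>

lemma has_real_derivative_moved_density:
  assumes \<xi>: "\<xi> \<in> \<B>" "y \<xi> \<in> U"
  shows "((\<lambda>\<epsilon>. moved_density A \<eta> \<epsilon> \<xi>) has_real_derivative
    (\<Sum>\<alpha>\<in>UNIV. pd \<alpha> \<eta> \<xi> * momentum U \<phi> A \<alpha> \<xi>) + \<eta> \<xi> * (vol (y\<Theta> \<xi>) * force U \<phi> A \<xi>)) (at 0)"
proof -
  let ?\<tau> = "dtensor_pull (\<Theta> (U, \<phi>)) (\<phi> (y \<xi>)) (\<lambda>\<alpha> B. dcoord (U, \<phi>) y \<alpha> B \<xi>) A (\<eta> \<xi>) (\<lambda>\<alpha>. pd \<alpha> \<eta> \<xi>)"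
  let ?v = "vol (y\<Theta> \<xi>)" and ?V = "\<U> \<circ> inv_into U \<phi>"
  let ?F = "F0 \<xi> (\<Delta> \<xi>) + \<U> (y \<xi>)"
  have v0: "?v > 0" using volume(3,4) \<xi> by auto
  note m0 = moved_tensor_0[OF \<xi>]
  have T: "((\<lambda>\<epsilon>. moved_tensor A \<eta> \<epsilon> \<xi> $ a) has_real_derivative ?\<tau> a) (at 0)" for a
    unfolding moved_tensor_def
    by (rule has_real_derivative_tensor_pull[OF smooth_on_differentiable[OF smooth_\<Theta>[OF chart \<xi>(2)]]]) simp
  have m0': "(\<chi> a. moved_tensor A \<eta> 0 \<xi> $ a - pullback \<A> \<Theta> x0 \<xi> $ a) = \<Delta> \<xi>"
    by (simp add: m0 deformation_def vec_eq_iff)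
  have mm: "(\<chi> a. moved_tensor A \<eta> \<epsilon> \<xi> $ a - pullback \<A> \<Theta> x0 \<xi> $ a) =
      moved_tensor A \<eta> \<epsilon> \<xi> - pullback \<A> \<Theta> x0 \<xi>" for \<epsilon>
    by (simp add: vec_eq_iff)
  have dF: "((\<lambda>\<epsilon>. F0 \<xi> (moved_tensor A \<eta> \<epsilon> \<xi> - pullback \<A> \<Theta> x0 \<xi>)) has_real_derivative
      (\<Sum>a\<in>UNIV. ?\<tau> a * pd a (F0 \<xi>) (\<Delta> \<xi>))) (at 0)"
    using has_real_derivative_compose_vec[of "F0 \<xi>" "\<lambda>a \<epsilon>. moved_tensor A \<eta> \<epsilon> \<xi> $ a - pullback \<A> \<Theta> x0 \<xi> $ a" 0,
        unfolded m0' mm, OF pd_F0(1)[OF elastic(3)[OF \<xi>(1)]] DERIV_diff[OF T DERIV_const]]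
    by simp
  have dvol: "((\<lambda>\<epsilon>. vol (moved_tensor A \<eta> \<epsilon> \<xi>)) has_real_derivative
      (\<Sum>a\<in>UNIV. ?\<tau> a * pd a vol (y\<Theta> \<xi>))) (at 0)"
    using has_real_derivative_compose_vec[of vol "\<lambda>a \<epsilon>. moved_tensor A \<eta> \<epsilon> \<xi> $ a" 0,
        unfolded vec_lambda_eta m0,
        OF smooth_on_differentiable[OF volume(2) volume(4)[OF \<xi>(1)]] T] .
  have dV: "((\<lambda>\<epsilon>. ?V (\<phi> (y \<xi>) + (\<epsilon> * \<eta> \<xi>) *\<^sub>R axis A 1)) has_real_derivative
      \<eta> \<xi> * pd A ?V (\<phi> (y \<xi>))) (at 0)"
    by (rule has_real_derivative_line[OF smooth_on_differentiable[OF smooth_\<U>_chart[OF chart \<xi>(2)]]]) simp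
  have V0: "?V (\<phi> (y \<xi>) + (0 * \<eta> \<xi>) *\<^sub>R axis A 1) = \<U> (y \<xi>)"
    using inv_into_f_f[OF smooth_atlasD(4)[OF manifold chart] \<xi>(2)] by simp
  have "((\<lambda>\<epsilon>. moved_density A \<eta> \<epsilon> \<xi>) has_real_derivative
      ((\<Sum>a\<in>UNIV. ?\<tau> a * pd a (F0 \<xi>) (\<Delta> \<xi>)) + \<eta> \<xi> * pd A ?V (\<phi> (y \<xi>))) * ?v +
      (\<Sum>a\<in>UNIV. ?\<tau> a * pd a vol (y\<Theta> \<xi>)) * ?F) (at 0)"
    using DERIV_mult[OF DERIV_add[OF dF dV] dvol]
    unfolding moved_density_def V0 m0 deformation_def by simp
  moreover have "((\<Sum>a\<in>UNIV. ?\<tau> a * pd a (F0 \<xi>) (\<Delta> \<xi>)) + \<eta> \<xi> * pd A ?V (\<phi> (y \<xi>))) * ?v +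
      (\<Sum>a\<in>UNIV. ?\<tau> a * pd a vol (y\<Theta> \<xi>)) * ?F =
      ?v * (\<Sum>a\<in>UNIV. \<Sigma> \<xi> $ a * ?\<tau> a) + \<eta> \<xi> * (?v * pd A ?V (\<phi> (y \<xi>)))"
  proof -
    have "?v * (\<Sigma> \<xi> $ a * ?\<tau> a) = ?\<tau> a * pd a (F0 \<xi>) (\<Delta> \<xi>) * ?v + ?\<tau> a * pd a vol (y\<Theta> \<xi>) * ?F" for a
      using v0 by (simp add: Stress_def pd_ln_vol[OF volume(4)[OF \<xi>(1)]] field_simps)
    then show ?thesis
      by (simp add: sum_distrib_left sum_distrib_right sum.distrib algebra_simps)
  qed
  moreover have "\<dots> = (\<Sum>\<alpha>\<in>UNIV. pd \<alpha> \<eta> \<xi> * momentum U \<phi> A \<alpha> \<xi>) + \<eta> \<xi> * (?v * force U \<phi> A \<xi>)"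
    unfolding sum_stress_dtensor_pull force_def[OF chart] momentum_def[OF chart]
    by (simp add: sum_distrib_left algebra_simps)
  ultimately show ?thesis by simp
qed

text \<open>At parameter 0 the moved data are those of \<open>y\<close>, known to lie in the domains
  of \<open>F0\<close>, \<open>vol\<close> and the chart fields; nearby parameters are covered by
  openness.\<close>

lemma smooth_moved_density:
  assumes \<eta>: "smooth_on UNIV \<eta>" and \<xi>: "\<xi> \<in> \<B>" "y \<xi> \<in> U"
  shows "smooth_on {(0, \<xi>)} (\<lambda>z. moved_density A \<eta> (fst z) (snd z))"
proof -
  note sndc = smooth_on_compose_snd[of \<xi> _ "0 :: real"]
  have at: "smooth_on {\<xi>} \<eta>" using \<eta> smooth_onD by blast
  let ?h = "\<lambda>z. \<phi> (y (snd z)) + (fst z * \<eta> (snd z)) *\<^sub>R axis A 1 :: real^'n"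
  have h: "smooth_on {(0, \<xi>)} ?h"
    by (intro smooth_on_add smooth_on_scaleR smooth_on_mult smooth_on_fst smooth_on_ident smooth_on_const
        sndc[OF at] sndc[OF smooth_u[OF chart \<xi>]])
  have \<Theta>h: "smooth_on {(0, \<xi>)} (\<lambda>z. \<Theta> (U, \<phi>) (?h z))"
    by (rule smooth_on_compose_at[OF _ h]) (simp add: smooth_\<Theta>[OF chart \<xi>(2)])
  have Vh: "smooth_on {(0, \<xi>)} (\<lambda>z. (\<U> \<circ> inv_into U \<phi>) (?h z))"
    by (rule smooth_on_compose_at[OF _ h]) (simp add: smooth_\<U>_chart[OF chart \<xi>(2), unfolded o_def] o_def)
  have T: "smooth_on {(0, \<xi>)} (\<lambda>z. moved_tensor A \<eta> (fst z) (snd z))"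
    unfolding moved_tensor_def
    by (rule smooth_on_tensor_pull[OF \<Theta>h])
      (intro smooth_on_add smooth_on_mult smooth_on_fst smooth_on_ident smooth_on_const
        sndc[OF smooth_dcoord[OF chart \<xi>]] sndc[OF smooth_on_pd[OF at]])
  have F: "smooth_on {(0, \<xi>)} (\<lambda>z. F0 (snd z) (moved_tensor A \<eta> (fst z) (snd z) - pullback \<A> \<Theta> x0 (snd z)))"
    by (rule smooth_F0_compose)
      (use elastic(3)[OF \<xi>(1)] in \<open>auto simp: moved_tensor_0[OF \<xi>] deformation_def
        intro!: smooth_on_diff T sndc smooth_x0\<Theta> \<xi> smooth_on_snd smooth_on_ident\<close>)
  have v: "smooth_on {(0, \<xi>)} (\<lambda>z. vol (moved_tensor A \<eta> (fst z) (snd z)))"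
    by (rule smooth_on_compose_at[OF _ T])
      (simp add: moved_tensor_0[OF \<xi>] smooth_onD[OF volume(2) volume(4)[OF \<xi>(1)]])
  show ?thesis unfolding moved_density_def by (intro smooth_on_mult smooth_on_add F Vh v)
qed

text \<open>The link between the explicit formula and an actual map. The coordinate identity is
  required near \<xi>, since slopes are compared as well as values.\<close>

lemma energy_density_chart:
  assumes "smooth_into \<A> {\<xi>} z" "z \<xi> \<in> U" and \<xi>: "\<xi> \<in> \<B>" "y \<xi> \<in> U" and \<eta>: "smooth_on UNIV \<eta>"
    and z: "eventually (\<lambda>x. \<phi> (z x) = \<phi> (y x) + (\<epsilon> * \<eta> x) *\<^sub>R axis A 1) (nhds \<xi>)"
  shows "energy_density z \<xi> = moved_density A \<eta> \<epsilon> \<xi>"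
proof -
  have at: "\<phi> (z \<xi>) = \<phi> (y \<xi>) + (\<epsilon> * \<eta> \<xi>) *\<^sub>R axis A 1"
    using eventually_nhds_x_imp_x[OF z] .
  have "dcoord (U, \<phi>) z \<alpha> B \<xi> = dcoord (U, \<phi>) y \<alpha> B \<xi> + \<epsilon> * (pd \<alpha> \<eta> \<xi> * (if B = A then 1 else 0))" for \<alpha> B
  proof -
    have "(\<phi> \<circ> y has_derivative frechet_derivative (\<phi> \<circ> y) (at \<xi>)) (at \<xi>)"
      by (rule smooth_on_has_derivative[OF smooth_into_chart[OF y_into[OF \<xi>(1)] chart \<xi>(2)]]) simp
    moreover have "(\<eta> has_derivative frechet_derivative \<eta> (at \<xi>)) (at \<xi>)"
      by (rule smooth_on_has_derivative[OF \<eta>]) simp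
    ultimately have "((\<lambda>x. (\<phi> \<circ> y) x + (\<epsilon> * \<eta> x) *\<^sub>R axis A 1) has_derivative
        (\<lambda>h. frechet_derivative (\<phi> \<circ> y) (at \<xi>) h + (\<epsilon> * frechet_derivative \<eta> (at \<xi>) h) *\<^sub>R axis A 1)) (at \<xi>)"
      by (intro has_derivative_add has_derivative_scaleR_left has_derivative_mult_right)
    from pd_eqI[OF this, of \<alpha>]
    have "pd \<alpha> (\<phi> \<circ> z) \<xi> = pd \<alpha> (\<phi> \<circ> y) \<xi> + (\<epsilon> * pd \<alpha> \<eta> \<xi>) *\<^sub>R axis A 1"
      using pd_cong_ev[of "\<phi> \<circ> z" "\<lambda>x. (\<phi> \<circ> y) x + (\<epsilon> * \<eta> x) *\<^sub>R axis A 1" \<xi> \<alpha>] z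
      by (simp add: pd_def)
    then show ?thesis by (simp add: dcoord_def axis_def)
  qed
  then have T: "pullback \<A> \<Theta> z \<xi> = moved_tensor A \<eta> \<epsilon> \<xi>"
    using pullback_chart[OF manifold tensor chart assms(2) smooth_into_isCont[OF assms(1)]
        smooth_on_differentiable[OF smooth_into_chart[OF assms(1) chart assms(2)]]]
    by (simp add: moved_tensor_def at)
  have "\<U> (z \<xi>) = (\<U> \<circ> inv_into U \<phi>) (\<phi> (y \<xi>) + (\<epsilon> * \<eta> \<xi>) *\<^sub>R axis A 1)"
    using inv_into_f_f[OF smooth_atlasD(4)[OF manifold chart] assms(2)] by (simp flip: at)
  then show ?thesis by (simp add: energy_density_def moved_density_def deformation_def T)
qed

lemma first_variation:
  assumes s: "s < r" and rB: "cball c r \<subseteq> interior \<B>" and rU: "y ` cball c r \<subseteq> U"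
    and \<eta>: "smooth_on UNIV \<eta>" "\<And>x. 0 \<le> \<eta> x" "\<And>x. \<eta> x \<le> 1" "\<And>x. x \<notin> cball c s \<Longrightarrow> \<eta> x = 0"
    and box: "cball c (s + 1) \<subseteq> cbox a b"
  shows "integral (cbox a b) (\<lambda>\<xi>. \<eta> \<xi> * residual U \<phi> A \<xi>) = 0"
proof -
  note cD = smooth_atlasD[OF manifold chart]
  have inj: "inv_into U \<phi> (\<phi> m) = m" if "m \<in> U" for m using that cD(4) by simp
  have ballB: "\<xi> \<in> \<B>" "y \<xi> \<in> U" if "\<xi> \<in> cball c r" for \<xi>
    using that rB rU interior_subset by blast+
  have "compact ((\<lambda>\<xi>. \<phi> (y \<xi>)) ` cball c r)"
    by (rule compact_continuous_image[OF smooth_on_continuous_on compact_cball],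
        rule smooth_onI, rule smooth_u[OF chart ballB])
  moreover have "(\<lambda>\<xi>. \<phi> (y \<xi>)) ` cball c r \<subseteq> \<phi> ` U" using ballB by auto
  \<comment> \<open>\<delta> is a uniform distance from the compact coordinate image to the outside
    of the chart; shorter moves stay in the chart.\<close>
  ultimately obtain \<delta> where \<delta>: "\<delta> > 0" "(\<Union>x\<in>(\<lambda>\<xi>. \<phi> (y \<xi>)) ` cball c r. ball x \<delta>) \<subseteq> \<phi> ` U"
    using compact_subset_open_imp_ball_epsilon_subset[OF _ cD(2)] by metis
  define H where "H \<epsilon> \<xi> = \<phi> (y \<xi>) + (\<epsilon> * \<eta> \<xi>) *\<^sub>R axis A 1" for \<epsilon> \<xi>
  \<comment> \<open>Between the radii \<open>s\<close> and \<open>r\<close> the bump function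
    vanishes and both branches equal \<open>y\<close>, so there is no seam at radius
    \<open>r\<close>.\<close>
  define Y where "Y \<epsilon> \<xi> = (if \<xi> \<in> ball c r then inv_into U \<phi> (H \<epsilon> \<xi>) else y \<xi>)" for \<epsilon> \<xi>
  have HU: "H \<epsilon> \<xi> \<in> \<phi> ` U" if "\<bar>\<epsilon>\<bar> < \<delta>" "\<xi> \<in> cball c r" for \<epsilon> \<xi>
  proof -
    have "\<bar>\<epsilon> * \<eta> \<xi>\<bar> \<le> \<bar>\<epsilon>\<bar> * 1"
      unfolding abs_mult using \<eta>(2,3)[of \<xi>] by (intro mult_left_mono) auto
    then have "H \<epsilon> \<xi> \<in> ball (\<phi> (y \<xi>)) \<delta>"
      using that by (simp add: H_def dist_norm norm_axis_1)
    then show ?thesis using \<delta>(2) that(2) by blast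
  qed
  have Y_out: "Y \<epsilon> \<xi> = y \<xi>" if "\<xi> \<notin> cball c s" for \<epsilon> \<xi>
    using that \<eta>(4) inj ballB(2)[of \<xi>] by (auto simp: Y_def H_def)
  have Y0: "Y 0 \<xi> = y \<xi>" for \<xi>
    using inj ballB(2)[of \<xi>] by (auto simp: Y_def H_def)
  have Y_in: "Y \<epsilon> \<xi> \<in> U" "\<phi> (Y \<epsilon> \<xi>) = H \<epsilon> \<xi>" if "\<bar>\<epsilon>\<bar> < \<delta>" "\<xi> \<in> ball c r" for \<epsilon> \<xi>
  proof -
    have "H \<epsilon> \<xi> \<in> \<phi> ` U" using HU that by auto
    then show "Y \<epsilon> \<xi> \<in> U" "\<phi> (Y \<epsilon> \<xi>) = H \<epsilon> \<xi>"
      using that by (auto simp: Y_def inv_into_into f_inv_into_f)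
  qed
  \<comment> \<open>Two open sets covering the space: on the first the chart formula holds, on the
    second nothing moves. The local claims below are split along them.\<close>
  have cases: "\<xi> \<in> ball c r \<or> \<xi> \<in> - cball c s" for \<xi> using s by auto
  have ev_out: "eventually (\<lambda>x. x \<notin> cball c s) (nhds \<xi>)" if "\<xi> \<in> - cball c s" for \<xi>
    using eventually_nhds_in_open[of "- cball c s" \<xi>] that by (simp add: open_Compl)
  have ev_in: "eventually (\<lambda>x. x \<in> ball c r) (nhds \<xi>)" if "\<xi> \<in> ball c r" for \<xi>
    using eventually_nhds_in_open[of "ball c r" \<xi>] that by simp
  have ev_snd: "eventually (\<lambda>z. Q (snd z)) (nhds (\<epsilon>, \<xi>))" if "eventually Q (nhds \<xi>)"
    for Q and \<epsilon> :: real and \<xi> :: "real^'d"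
  proof -
    have "filterlim snd (nhds \<xi>) (nhds (\<epsilon>, \<xi>))"
      using tendsto_snd[OF tendsto_ident_at[of "(\<epsilon>, \<xi>)" UNIV, folded nhds_def]] filterlim_ident
      by (metis isCont_snd continuous_ident tendsto_at_iff_tendsto_nhds isCont_def snd_conv)
    then show ?thesis using that by (simp add: filterlim_iff)
  qed
  have Y_smooth: "smooth_into \<A> {(\<epsilon>, \<xi>)} (\<lambda>z. Y (fst z) (snd z))" if e: "\<bar>\<epsilon>\<bar> < \<delta>" and \<xi>: "\<xi> \<in> \<B>" for \<epsilon> \<xi>
    using cases[of \<xi>]
  proof
    assume in_ball: "\<xi> \<in> ball c r"
    note sndc = smooth_on_compose_snd[of \<xi> _ \<epsilon>]
    have "smooth_on {(\<epsilon>, \<xi>)} (\<lambda>z. H (fst z) (snd z))"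
      unfolding H_def
      by (intro smooth_on_add smooth_on_scaleR smooth_on_mult smooth_on_fst smooth_on_ident smooth_on_const
        sndc[OF smooth_onD[OF \<eta>(1)]] sndc[OF smooth_u[OF chart]] ballB) (use in_ball in auto)
    then have "smooth_into \<A> {(\<epsilon>, \<xi>)} (\<lambda>z. inv_into U \<phi> (H (fst z) (snd z)))"
      using HU[OF e, of \<xi>] in_ball
      by (intro smooth_into_compose[OF smooth_into_inv_chart[OF manifold chart] _ manifold]) auto
    moreover have "eventually (\<lambda>z. inv_into U \<phi> (H (fst z) (snd z)) = Y (fst z) (snd z)) (nhds (\<epsilon>, \<xi>))"
      using ev_snd[OF ev_in[OF in_ball]] by eventually_elim (simp add: Y_def)
    ultimately show ?thesis by (rule smooth_into_cong_ev[OF _ _ manifold])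
  next
    assume out: "\<xi> \<in> - cball c s"
    have "smooth_into \<A> {(\<epsilon>, \<xi>)} (\<lambda>z. y (snd z))"
      by (rule smooth_into_compose[OF _ _ manifold]) (use y_into[OF \<xi>] in \<open>auto intro: smooth_intros\<close>)
    moreover have "eventually (\<lambda>z. y (snd z) = Y (fst z) (snd z)) (nhds (\<epsilon>, \<xi>))"
      using ev_snd[OF ev_out[OF out]] by eventually_elim (simp add: Y_out)
    ultimately show ?thesis by (rule smooth_into_cong_ev[OF _ _ manifold])
  qed
  have Y\<epsilon>_smooth: "smooth_into \<A> {\<xi>} (Y \<epsilon>)" if "\<bar>\<epsilon>\<bar> < \<delta>" "\<xi> \<in> \<B>" for \<epsilon> \<xi>
    using smooth_into_compose[where f = "\<lambda>\<xi>. (\<epsilon>, \<xi>)", OF Y_smooth[OF that] smooth_on_Pair[OF smooth_on_const smooth_on_ident] manifold]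
    by simp

  have variation: "smooth_variation \<A> \<B> y Y"
    unfolding smooth_variation_def
  proof (intro conjI ballI exI)
    show "smooth_into \<A> ({-\<delta><..<\<delta>} \<times> \<B>) (\<lambda>(\<epsilon>, \<xi>). Y \<epsilon> \<xi>)"
      unfolding smooth_into_pointwise[of _ "_ \<times> _"] using Y_smooth by (auto simp: case_prod_unfold)
  qed (use Y0 \<delta> in auto)
  have fixed_boundary: "variation_field_zero_on \<A> (frontier \<B>) Y"
    unfolding variation_field_zero_on_def
  proof (intro ballI, clarify)
    fix \<xi> V \<psi> assume "\<xi> \<in> frontier \<B>"
    then have "\<xi> \<notin> cball c r" using rB by (auto simp: frontier_def)
    then have "\<xi> \<notin> cball c s" using s by auto
    then show "((\<lambda>\<epsilon>. \<psi> (Y \<epsilon> \<xi>)) has_vector_derivative 0) (at 0)" by (simp add: Y_out)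
  qed
  note stat = stationary[OF variation fixed_boundary]

  \<comment> \<open>Subtracting the density of \<open>y\<close> leaves a function supported in
    \<open>cball c s\<close>, hence smooth also outside the body, where \<open>y\<close> is not
    controlled.\<close>
  define G where "G z = energy_density (Y (fst z)) (snd z) - energy_density y (snd z)" for z :: "real \<times> (real^'d)"
  define g where "g \<xi> = (\<Sum>\<alpha>\<in>UNIV. pd \<alpha> \<eta> \<xi> * momentum U \<phi> A \<alpha> \<xi>) + \<eta> \<xi> * (vol (y\<Theta> \<xi>) * force U \<phi> A \<xi>)" for \<xi>
  have energy_density_y0: "energy_density y \<xi> = energy_density (Y 0) \<xi>" for \<xi> by (rule energy_density_cong_ev) (simp add: Y0)
  have G_out: "G (\<epsilon>, \<xi>) = 0" if "\<xi> \<notin> cball c s" for \<epsilon> \<xi>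
    using energy_density_cong_ev[of "Y \<epsilon>" y \<xi>] eventually_mono[OF ev_out[of \<xi>] Y_out] that by (simp add: G_def)
  have G_in: "G (\<epsilon>, \<xi>) = moved_density A \<eta> \<epsilon> \<xi> - moved_density A \<eta> 0 \<xi>"
    if "\<bar>\<epsilon>\<bar> < \<delta>" "\<xi> \<in> ball c r" for \<epsilon> \<xi>
  proof -
    have "energy_density (Y \<epsilon>) \<xi> = moved_density A \<eta> \<epsilon> \<xi>" if "\<bar>\<epsilon>\<bar> < \<delta>" for \<epsilon>
    proof (rule energy_density_chart[OF Y\<epsilon>_smooth Y_in(1) _ _ \<eta>(1)])
      show "eventually (\<lambda>x. \<phi> (Y \<epsilon> x) = \<phi> (y x) + (\<epsilon> * \<eta> x) *\<^sub>R axis A 1) (nhds \<xi>)"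
        using ev_in[OF \<open>\<xi> \<in> ball c r\<close>] by eventually_elim (simp add: Y_in(2)[OF that] H_def)
    qed (use that \<open>\<xi> \<in> ball c r\<close> ballB[of \<xi>] in auto)
    then show ?thesis using that \<delta> by (simp add: G_def energy_density_y0)
  qed
  have ev_fst: "eventually (\<lambda>z. \<bar>fst z\<bar> < \<delta>) (nhds (0, \<xi>))" for \<xi> :: "real^'d"
  proof -
    have "open {z :: real \<times> (real^'d). \<bar>fst z\<bar> < \<delta>}" by (intro open_Collect_less continuous_intros)
    then show ?thesis using eventually_nhds_in_open[of "{z :: real \<times> (real^'d). \<bar>fst z\<bar> < \<delta>}" "(0, \<xi>)"] \<delta> by simp
  qed
  have G_smooth: "smooth_on {(0, \<xi>)} G" for \<xi>
    using cases[of \<xi>]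
  proof
    assume in_ball: "\<xi> \<in> ball c r"
    then have \<xi>: "\<xi> \<in> \<B>" "y \<xi> \<in> U" using ballB[of \<xi>] by auto
    have m: "smooth_on {(0, \<xi>)} (\<lambda>z. moved_density A \<eta> (fst z) (snd z))"
      by (rule smooth_moved_density[OF \<eta>(1) \<xi>])
    \<comment> \<open>The subtracted density at parameter 0 is the joint one composed with
      \<open>\<lambda>z. (0, snd z)\<close>.\<close>
    have "smooth_on {(0, \<xi>)} (\<lambda>z. moved_density A \<eta> (fst (0 :: real, snd z)) (snd (0 :: real, snd z)))"
      by (rule smooth_on_compose_at[where f = "\<lambda>z. (0, snd z)"])
        (use m in \<open>simp_all add: smooth_on_Pair[OF smooth_on_const smooth_on_snd[OF smooth_on_ident]]\<close>)
    then have "smooth_on {(0, \<xi>)} (\<lambda>z. moved_density A \<eta> (fst z) (snd z) - moved_density A \<eta> 0 (snd z))"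
      by (intro smooth_on_diff m) simp
    moreover have "eventually (\<lambda>z. moved_density A \<eta> (fst z) (snd z) - moved_density A \<eta> 0 (snd z) = G z) (nhds (0, \<xi>))"
      using ev_fst ev_snd[OF ev_in[OF in_ball]] by eventually_elim (metis G_in prod.collapse)
    ultimately show ?thesis by (rule smooth_on_cong_ev)
  next
    assume out: "\<xi> \<in> - cball c s"
    have "eventually (\<lambda>z. 0 = G z) (nhds (0, \<xi>))"
      using ev_snd[OF ev_out[OF out]] by eventually_elim (metis G_out prod.collapse)
    then show ?thesis by (rule smooth_on_cong_ev[OF smooth_on_const])
  qed
  have \<eta>_out: "\<eta> \<xi> = 0" "pd \<alpha> \<eta> \<xi> = 0" if "\<xi> \<in> - cball c s" for \<xi> \<alpha>
  proof -
    have "eventually (\<lambda>x. \<eta> x = 0) (nhds \<xi>)"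
      using ev_out[OF that] by eventually_elim (rule \<eta>(4))
    then have "pd \<alpha> \<eta> \<xi> = pd \<alpha> (\<lambda>_. 0) \<xi>" by (rule pd_cong_ev)
    then show "pd \<alpha> \<eta> \<xi> = 0" by (simp add: pd_def frechet_derivative_const)
    show "\<eta> \<xi> = 0" using \<eta>(4) that by simp
  qed
  have G_deriv: "((\<lambda>\<epsilon>. G (\<epsilon>, \<xi>)) has_real_derivative g \<xi>) (at 0)" for \<xi>
    using cases[of \<xi>]
  proof
    assume in_ball: "\<xi> \<in> ball c r"
    then have \<xi>: "\<xi> \<in> \<B>" "y \<xi> \<in> U" using ballB[of \<xi>] by auto
    have "((\<lambda>\<epsilon>. moved_density A \<eta> \<epsilon> \<xi> - moved_density A \<eta> 0 \<xi>) has_real_derivative g \<xi> - 0) (at 0)"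
      unfolding g_def by (intro DERIV_diff has_real_derivative_moved_density[OF \<xi>] DERIV_const)
    then have "((\<lambda>\<epsilon>. moved_density A \<eta> \<epsilon> \<xi> - moved_density A \<eta> 0 \<xi>) has_real_derivative g \<xi>) (at 0)" by simp
    then show ?thesis
      by (rule has_field_derivative_transform_within_open[of _ _ _ "{-\<delta><..<\<delta>}"])
        (use \<delta> G_in in_ball in auto)
  next
    assume "\<xi> \<in> - cball c s"
    then show ?thesis by (simp add: G_out g_def \<eta>_out)
  qed

  note int = has_real_derivative_integral_cbox[of a b G g, OF smooth_onI G_deriv]
  have int1: "((\<lambda>\<epsilon>. integral (cbox a b) (\<lambda>x. G (\<epsilon>, x))) has_real_derivative integral (cbox a b) g) (at 0)"
    and int2: "eventually (\<lambda>\<epsilon>. (\<lambda>x. G (\<epsilon>, x)) integrable_on cbox a b) (nhds 0)"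
    by (rule int; use G_smooth in auto)+
  have energy: "energy \<A> \<Theta> \<B> x0 F0 \<U> vol (Y \<epsilon>) = integral \<B> (energy_density y) + integral (cbox a b) (\<lambda>x. G (\<epsilon>, x))"
    if "(\<lambda>x. G (\<epsilon>, x)) integrable_on cbox a b" for \<epsilon>
  proof -
    let ?g = "\<lambda>x. G (\<epsilon>, x)"
    have "x \<notin> cball c s" if "x \<notin> cbox a b" for x
      using subsetD[OF box, of x] that by auto
    then have I: "(?g has_integral integral (cbox a b) ?g) UNIV"
      by (intro has_integral_on_superset[OF integrable_integral[OF that]] G_out) auto
    \<comment> \<open>Body and box both contain the support, so the integral over either one is the
      integral over the whole space.\<close>
    have eq: "(\<lambda>x. if x \<in> \<B> then ?g x else 0) = ?g"
    proof
      fix x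
      have "x \<notin> cball c s" if "x \<notin> \<B>" using that ballB(1)[of x] s by auto
      then show "(if x \<in> \<B> then ?g x else 0) = ?g x" using G_out by auto
    qed
    have "(?g has_integral integral (cbox a b) ?g) \<B>"
      using I has_integral_restrict[OF subset_UNIV, of \<B> ?g] unfolding eq by blast
    from has_integral_add[OF integrable_integral[OF energy_density_integrable] this]
    have "(energy_density (Y \<epsilon>) has_integral integral \<B> (energy_density y) + integral (cbox a b) ?g) \<B>"
      by (simp add: G_def)
    then show ?thesis unfolding energy_eq_integral by (rule integral_unique)
  qed
  \<comment> \<open>The energy along \<open>Y\<close> is differentiated twice over: stationarity
    gives 0, the Leibniz rule the integral of \<open>g\<close>.\<close>
  have "((\<lambda>\<epsilon>. integral \<B> (energy_density y) + integral (cbox a b) (\<lambda>x. G (\<epsilon>, x))) has_real_derivative 0 + integral (cbox a b) g) (at 0)"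
    by (intro DERIV_add DERIV_const int1)
  moreover have "((\<lambda>\<epsilon>. integral \<B> (energy_density y) + integral (cbox a b) (\<lambda>x. G (\<epsilon>, x))) has_real_derivative 0) (at 0)"
    using stat DERIV_cong_ev[OF refl eventually_mono[OF int2 energy] refl] by simp
  ultimately have g0: "integral (cbox a b) g = 0" using DERIV_unique by fastforce

  \<comment> \<open>By the product rule \<open>g\<close> is the divergence of this compactly
    supported field minus \<eta> times the residual, and the divergence integrates to 0.\<close>
  define h where "h \<alpha> \<xi> = \<eta> \<xi> * momentum U \<phi> A \<alpha> \<xi>" for \<alpha> \<xi>
  \<comment> \<open>The factor \<eta> extends fields known only near body points mapped into
    \<open>U\<close> smoothly by 0 to the whole space.\<close>
  have smooth_\<eta>: "smooth_on UNIV (\<lambda>\<xi>. \<eta> \<xi> * f \<xi>)" if "\<And>\<xi>. \<xi> \<in> \<B> \<Longrightarrow> y \<xi> \<in> U \<Longrightarrow> smooth_on {\<xi>} f" for f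
  proof (rule smooth_onI)
    fix \<xi>
    show "smooth_on {\<xi>} (\<lambda>\<xi>. \<eta> \<xi> * f \<xi>)"
      using cases[of \<xi>]
    proof
      assume "\<xi> \<in> ball c r"
      then show ?thesis using ballB[of \<xi>] by (intro smooth_on_mult smooth_onD[OF \<eta>(1)] that) auto
    next
      assume "\<xi> \<in> - cball c s"
      then have "eventually (\<lambda>x. 0 = \<eta> x * f x) (nhds \<xi>)"
        using eventually_mono[OF ev_out[of \<xi>], of "\<lambda>x. 0 = \<eta> x * f x"] \<eta>(4) by simp
      then show ?thesis by (rule smooth_on_cong_ev[OF smooth_on_const])
    qed
  qed
  have h: "smooth_on UNIV (h \<alpha>)" for \<alpha>
    unfolding h_def[abs_def] by (rule smooth_\<eta>) (rule smooth_momentum[OF chart])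
  have res: "smooth_on UNIV (\<lambda>\<xi>. \<eta> \<xi> * residual U \<phi> A \<xi>)"
    by (rule smooth_\<eta>) (rule smooth_residual[OF chart])
  have g_eq: "g \<xi> = (\<Sum>\<alpha>\<in>UNIV. pd \<alpha> (h \<alpha>) \<xi>) - \<eta> \<xi> * residual U \<phi> A \<xi>" for \<xi>
    using cases[of \<xi>]
  proof
    assume "\<xi> \<in> ball c r"
    then have \<xi>: "\<xi> \<in> \<B>" "y \<xi> \<in> U" using ballB[of \<xi>] by auto
    have "pd \<alpha> (h \<alpha>) \<xi> = \<eta> \<xi> * pd \<alpha> (momentum U \<phi> A \<alpha>) \<xi> + pd \<alpha> \<eta> \<xi> * momentum U \<phi> A \<alpha> \<xi>" for \<alpha>
      unfolding h_def[abs_def]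
      by (subst pd_eqI[OF has_derivative_mult[OF smooth_on_has_derivative[OF \<eta>(1)]
              smooth_on_has_derivative[OF smooth_momentum[OF chart \<xi>]]]]) (auto simp: pd_def)
    then show ?thesis
      by (simp add: g_def residual_def[OF chart] sum.distrib sum_distrib_left algebra_simps)
  next
    assume out: "\<xi> \<in> - cball c s"
    have "pd \<alpha> (h \<alpha>) \<xi> = pd \<alpha> (\<lambda>_. 0) \<xi>" for \<alpha>
      by (rule pd_cong_ev) (use ev_out[OF out] in \<open>auto elim!: eventually_mono simp: h_def \<eta>(4)\<close>)
    then have "pd \<alpha> (h \<alpha>) \<xi> = 0" for \<alpha> by (simp add: pd_def frechet_derivative_const)
    then show ?thesis by (simp add: g_def \<eta>_out[OF out])
  qed
  have intpd: "pd \<alpha> (h \<alpha>) integrable_on cbox a b" for \<alpha>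
    by (intro integrable_continuous smooth_on_continuous_on smooth_on_pd)
      (rule smooth_onI, rule smooth_onD[OF h], simp)
  have intres: "(\<lambda>\<xi>. \<eta> \<xi> * residual U \<phi> A \<xi>) integrable_on cbox a b"
    by (intro integrable_continuous smooth_on_continuous_on) (rule smooth_onI, rule smooth_onD[OF res], simp)
  have "integral (cbox a b) g = (\<Sum>\<alpha>\<in>UNIV. integral (cbox a b) (pd \<alpha> (h \<alpha>)))
      - integral (cbox a b) (\<lambda>\<xi>. \<eta> \<xi> * residual U \<phi> A \<xi>)"
    unfolding g_eq[abs_def] using intpd intres by (simp add: integral_diff integral_sum integrable_sum)
  moreover have "integral (cbox a b) (pd \<alpha> (h \<alpha>)) = 0" for \<alpha>
    by (rule integral_pd_eq_0[OF h _ box]) (simp add: h_def \<eta>(4))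
  ultimately show ?thesis using g0 by simp
qed

section \<open>Vanishing of the residual, inside and at the boundary\<close>

lemma residual_interior_eq_0:
  assumes c: "c \<in> interior \<B>" "y c \<in> U"
  shows "residual U \<phi> A c = 0"
proof (rule ccontr)
  let ?R = "residual U \<phi> A"
  assume neq: "?R c \<noteq> 0"
  have cB: "c \<in> \<B>" using c interior_subset by blast
  \<comment> \<open>The factor \<open>?R c\<close> makes the product positive near \<open>c\<close>
    whichever sign the residual has there, which avoids a case split.\<close>
  have "eventually (\<lambda>x. x \<in> interior \<B> \<and> y x \<in> U \<and> ?R x * ?R c > 0) (nhds c)"
  proof (intro eventually_conj)
    show "eventually (\<lambda>x. x \<in> interior \<B>) (nhds c)"
      using c by (intro eventually_nhds_in_open) auto
    show "eventually (\<lambda>x. y x \<in> U) (nhds c)"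
      by (rule isCont_eventually_in[OF smooth_into_isCont[OF y_into[OF cB]] smooth_atlasD(1)[OF manifold chart] c(2)])
    have "isCont (\<lambda>x. ?R x * ?R c) c"
      by (intro continuous_intros smooth_on_isCont[OF smooth_residual[OF chart cB c(2)]]) simp
    then show "eventually (\<lambda>x. ?R x * ?R c > 0) (nhds c)"
      using isCont_eventually_in[of c "\<lambda>x. ?R x * ?R c" "{0<..}"] neq not_real_square_gt_zero[of "?R c"]
      by (simp del: not_real_square_gt_zero)
  qed
  then obtain S where S: "open S" "c \<in> S" "\<And>x. x \<in> S \<Longrightarrow> x \<in> interior \<B> \<and> y x \<in> U \<and> ?R x * ?R c > 0"
    by (auto simp: eventually_nhds)
  obtain r where "r > 0" "cball c r \<subseteq> S"
    using S(1,2) open_contains_cball by blast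
  then have r: "r > 0" "cball c r \<subseteq> {x. x \<in> interior \<B> \<and> y x \<in> U \<and> ?R x * ?R c > 0}"
    using S(3) by auto
  define s where "s = r / 2"
  have s: "0 < s" "s < r" using r by (auto simp: s_def)
  obtain \<eta> :: "real^'d \<Rightarrow> real" where \<eta>: "smooth_on UNIV \<eta>" "\<And>x. 0 \<le> \<eta> x" "\<And>x. \<eta> x \<le> 1"
    "\<eta> c > 0" "\<And>x. x \<notin> cball c s \<Longrightarrow> \<eta> x = 0"
    using bump_function_exists[OF s(1)] by blast
  obtain a where a: "cball c (s + 1) \<subseteq> cbox (- a) a"
    using bounded_subset_cbox_symmetric[OF bounded_cball] .
  let ?f = "\<lambda>x. \<eta> x * (?R x * ?R c)"
  have "integral (cbox (- a) a) ?f = integral (cbox (- a) a) (\<lambda>x. \<eta> x * ?R x) * ?R c"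
    by (simp add: mult.assoc flip: integral_mult_left)
  also have "integral (cbox (- a) a) (\<lambda>x. \<eta> x * ?R x) = 0"
    by (rule first_variation[OF s(2) _ _ \<eta>(1,2,3,5) a]) (use r in auto)
  finally have int0: "integral (cbox (- a) a) ?f = 0" by simp
  have nonneg: "0 \<le> ?f x" for x
  proof (cases "x \<in> cball c s")
    case True
    then have "x \<in> cball c r" using s by auto
    then have "?R x * ?R c > 0" using r(2) by blast
    then show ?thesis using \<eta>(2) by simp
  qed (simp add: \<eta>(5))
  have cont: "continuous_on (cbox (- a) a) ?f"
  proof (rule continuous_at_imp_continuous_on, rule ballI)
    fix x
    show "isCont ?f x"
    proof (cases "x \<in> ball c r")
      case True
      then have "x \<in> cball c r" by simp
      then have "x \<in> \<B>" "y x \<in> U" using r(2) interior_subset by blast+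
      then show ?thesis
        by (intro continuous_intros smooth_on_isCont[OF smooth_residual[OF chart]] smooth_on_isCont[OF \<eta>(1)]) auto
    next
      case False
      then have "x \<in> - cball c s" using s by auto
      then have "eventually (\<lambda>x. ?f x = 0) (nhds x)"
        using eventually_nhds_in_open[of "- cball c s" x] by (auto elim!: eventually_mono simp: \<eta>(5) open_Compl)
      then show ?thesis using isCont_cong[of ?f "\<lambda>_. 0" x] by simp
    qed
  qed
  \<comment> \<open>A unit ball fits because the box contains radius \<open>s + 1\<close>; hence its
    interior is nonempty, as \<open>integral_cbox_eq_0_iff\<close> requires.\<close>
  have "ball c 1 \<subseteq> cbox (- a) a" using a s by (auto simp: subset_eq)
  then have "ball c 1 \<subseteq> box (- a) a"
    using interior_maximal[of "ball c 1" "cbox (- a) a"] by (simp add: interior_cbox)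
  then have "box (- a) a \<noteq> {}" "c \<in> cbox (- a) a"
    using box_subset_cbox by force+
  then have "?f c = 0" using integral_cbox_eq_0_iff[OF cont] nonneg int0 by blast
  then show False using neq \<eta>(4) by simp
qed

lemma residual_eq_0:
  assumes \<xi>: "\<xi> \<in> \<B>" "y \<xi> \<in> U"
  shows "residual U \<phi> A \<xi> = 0"
proof (rule ccontr)
  assume "residual U \<phi> A \<xi> \<noteq> 0"
  then have "eventually (\<lambda>x. residual U \<phi> A x \<in> - {0}) (nhds \<xi>)"
    by (intro isCont_eventually_in smooth_on_isCont[OF smooth_residual[OF chart \<xi>]]) auto
  \<comment> \<open>The residual is formed in the fixed chart, so the nearby interior point must
    also be mapped into \<open>U\<close>.\<close>
  moreover have "eventually (\<lambda>x. y x \<in> U) (nhds \<xi>)"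
    by (rule isCont_eventually_in[OF smooth_into_isCont[OF y_into[OF \<xi>(1)]] smooth_atlasD(1)[OF manifold chart] \<xi>(2)])
  ultimately have "eventually (\<lambda>x. residual U \<phi> A x \<in> - {0} \<and> y x \<in> U) (nhds \<xi>)" by (rule eventually_conj)
  then obtain S where S: "open S" "\<xi> \<in> S" "\<And>x. x \<in> S \<Longrightarrow> residual U \<phi> A x \<in> - {0} \<and> y x \<in> U"
    by (auto simp: eventually_nhds)
  have "\<xi> \<in> closure (interior \<B>)" using body(2) \<xi> by simp
  then obtain x where "x \<in> S" "x \<in> interior \<B>"
    using S(1,2) by (auto simp: closure_iff_nhds_not_empty)
  then show False using residual_interior_eq_0[of x] S(3)[of x] by simp
qed

end
end

theorem mainTheorem12:
  fixes \<A> :: "('m::{t2_space,second_countable_topology}, 'n::finite) chart set"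
    and \<Theta> :: "('m, 'n, 'p::finite) tensor"
    and \<B> :: "(real^'d::finite) set"
    and x0 y :: "real^'d \<Rightarrow> 'm"
    and F0 :: "real^'d \<Rightarrow> real^('p \<Rightarrow> 'd) \<Rightarrow> real"
    and \<U> :: "'m \<Rightarrow> real"
    and vol :: "real^('p \<Rightarrow> 'd) \<Rightarrow> real"
    and D :: "((real^'d) \<times> (real^('p \<Rightarrow> 'd))) set"
    and P :: "(real^('p \<Rightarrow> 'd)) set"
    and \<Sigma> :: "real^'d \<Rightarrow> real^('p \<Rightarrow> 'd)"
  defines "\<Sigma> \<equiv> Stress \<A> \<Theta> x0 F0 \<U> vol y"
  assumes manifold: "smooth_atlas \<A>"
    and tensor: "covariant_tensor_field \<A> \<Theta>"
    and body: "compact \<B>" "closure (interior \<B>) = \<B>"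
    and initial: "smooth_embedding \<A> \<B> x0"
    and current: "smooth_embedding \<A> \<B> y"
    and potential: "smooth_function \<A> \<U>"
    and elastic: "open D" "smooth_on D (\<lambda>(\<xi>, t). F0 \<xi> t)"
      "\<And>\<xi>. \<xi> \<in> \<B> \<Longrightarrow> (\<xi>, deformation \<A> \<Theta> x0 y \<xi>) \<in> D"
    and volume: "open P" "smooth_on P vol" "\<And>t. t \<in> P \<Longrightarrow> vol t > 0"
      "\<And>\<xi>. \<xi> \<in> \<B> \<Longrightarrow> pullback \<A> \<Theta> y \<xi> \<in> P"
    and stationary: "\<And>Y. smooth_variation \<A> \<B> y Y \<Longrightarrow> variation_field_zero_on \<A> (frontier \<B>) Y \<Longrightarrow>
      ((\<lambda>\<epsilon>. energy \<A> \<Theta> \<B> x0 F0 \<U> vol (Y \<epsilon>)) has_real_derivative 0) (at 0)"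
  shows "\<forall>(U, \<phi>)\<in>\<A>. \<forall>\<xi>\<in>\<B>. y \<xi> \<in> U \<longrightarrow> (\<forall>A.
      1 / vol (pullback \<A> \<Theta> y \<xi>) *
        (\<Sum>\<alpha>\<in>UNIV. pd \<alpha> (\<lambda>\<eta>. vol (pullback \<A> \<Theta> y \<eta>) * Stress_tilde (U, \<phi>) \<Theta> y \<Sigma> \<alpha> A \<eta>) \<xi>)
      - (\<Sum>a\<in>UNIV. \<Sum>B\<in>UNIV. \<Sigma> \<xi> $ a * pd A (\<lambda>x. \<Theta> (U, \<phi>) x $ B) (\<phi> (y \<xi>)) *
           (\<Prod>r\<in>UNIV. dcoord (U, \<phi>) y (a r) (B r) \<xi>))
      - pd A (\<U> \<circ> inv_into U \<phi>) (\<phi> (y \<xi>)) = 0)"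
proof (clarify)
  fix U \<phi> \<xi> A
  assume chart: "(U, \<phi>) \<in> \<A>" and \<xi>: "\<xi> \<in> \<B>" "y \<xi> \<in> U"
  interpret stationary_embedding \<A> \<Theta> \<B> x0 y F0 \<U> vol D P
    using assms by unfold_locales (auto simp: smooth_embedding_def)
  have "vol (pullback \<A> \<Theta> y \<xi>) > 0" using volume(3,4) \<xi> by blast
  moreover have "residual U \<phi> A \<xi> = 0" by (rule residual_eq_0[OF chart \<xi>])
  ultimately show "1 / vol (pullback \<A> \<Theta> y \<xi>) *
        (\<Sum>\<alpha>\<in>UNIV. pd \<alpha> (\<lambda>\<eta>. vol (pullback \<A> \<Theta> y \<eta>) * Stress_tilde (U, \<phi>) \<Theta> y \<Sigma> \<alpha> A \<eta>) \<xi>)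
      - (\<Sum>a\<in>UNIV. \<Sum>B\<in>UNIV. \<Sigma> \<xi> $ a * pd A (\<lambda>x. \<Theta> (U, \<phi>) x $ B) (\<phi> (y \<xi>)) *
           (\<Prod>r\<in>UNIV. dcoord (U, \<phi>) y (a r) (B r) \<xi>))
      - pd A (\<U> \<circ> inv_into U \<phi>) (\<phi> (y \<xi>)) = 0"
    unfolding residual_def[OF chart] momentum_def[OF chart, abs_def] force_def[OF chart] \<Sigma>_def
    by (simp add: field_simps)
qed

end
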